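(* Let $\rho>\max\{0,-\alpha\}$, $0<\gamma<\sigma\le 1$, $p>1$, $\frac1p+\frac1q=1$, and suppose $U(\infty)=V(\infty)=\infty$. Then the constant factor $k(\sigma)$ is the best possible in each of the following inequalities, which hold for all measurable $f\ge 0$ on $\mathbf{R}_+$ and all sequences $a_n\ge 0$ with $0<\|f\|_{p,\Phi_\delta}<\infty$, $0<\|a\|_{q,\Psi_\beta}<\infty$: $$\sum_{n=1}^\infty\int_0^\infty K_\delta(x,n)\,a_n f(x)\,dx<k(\sigma)\,\|f\|_{p,\Phi_\delta}\|a\|_{q,\Psi_\beta},$$ $$\left\{\sum_{n=1}^\infty\frac{\nu_{n+1}}{(V_n-\beta)^{1-p\sigma}}\left[\int_0^\infty K_\delta(x,n)f(x)\,dx\right]^p\right\}^{1/p}<k(\sigma)\,\|f\|_{p,\Phi_\delta},$$ $$\left\{\int_0^\infty\frac{\mu(x)}{U^{1-q\delta\sigma}(x)}\left[\sum_{n=1}^\infty K_\delta(x,n)a_n\right]^q dx\right\}^{1/q}<k(\sigma)\,\|a\|_{q,\Psi_\beta}.$$ That is, for the given parameters, $\mu$ and $\{\nu_n\}$, in none of these inequalities can $k(\sigma)$ be replaced by a smaller positive constant so that the inequality remains valid for all such $f$ and $a$.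
   Context: Setting. $\mathbf{R}_+=(0,\infty)$, $\mathbf{N}=\{1,2,\dots\}$, and $\alpha,\rho,\gamma,\sigma,\beta$ are real. $\{\nu_n\}_{n\ge1}$ is a decreasing (i.e. $\nu_{n+1}\le\nu_n$) sequence of positive reals, $V_n=\sum_{j=1}^n\nu_j$, $V(\infty)=\sum_{j=1}^\infty\nu_j$, and $\beta\le\nu_1/2$. $\mu$ is a positive continuous function on $\mathbf{R}_+$ with $U(x):=\int_0^x\mu(t)\,dt<\infty$ for all $x>0$, and $U(\infty)=\lim_{x\to\infty}U(x)$. $\delta\in\{-1,1\}$ is fixed. Powers such as $U^{s}(x)$ mean $(U(x))^{s}$. Kernel: with $\operatorname{csch}(u)=\frac{2}{e^u-e^{-u}}$ ($u>0$), $$K_\delta(x,n):=\frac{\operatorname{csch}\big(\rho\,U^{\delta\gamma}(x)(V_n-\beta)^\gamma\big)}{e^{\alpha U^{\delta\gamma}(x)(V_n-\beta)^\gamma}}.$$ Constant: $$k(\sigma):=\int_0^\infty\frac{\operatorname{csch}(\rho t^\gamma)}{e^{\alpha t^\gamma}}t^{\sigma-1}dt=\frac{2\Gamma(\sigma/\gamma)}{\gamma(2\rho)^{\sigma/\gamma}}\,\zeta\!\left(\frac{\sigma}{\gamma},\frac{\alpha+\rho}{2\rho}\right),$$ where $\zeta(s,a)=\sum_{k=0}^\infty (k+a)^{-s}$ ($s>1$, $a>0$) is the Hurwitz zeta function. Norms: $\Phi_\delta(x):=\frac{U^{p(1-\delta\sigma)-1}(x)}{\mu^{p-1}(x)}$,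 $\Psi_\beta(n):=\frac{(V_n-\beta)^{q(1-\sigma)-1}}{\nu_{n+1}^{q-1}}$, $\|f\|_{p,\Phi_\delta}=\left(\int_0^\infty\Phi_\delta(x)f^p(x)\,dx\right)^{1/p}$, $\|a\|_{q,\Psi_\beta}=\left(\sum_{n=1}^\infty\Psi_\beta(n)a_n^q\right)^{1/q}$. *)

theory Defs
  imports "HOL-Analysis.Analysis"
begin

text \<open>
  Integrals over \<open>(0,\<infinity>)\<close> are Lebesgue integrals with respect to \<open>lebesgue_on {0<..}\<close>. Integrals and
  series of nonnegative terms whose finiteness is not known beforehand are taken in \<open>ennreal\<close>, so
  that an upper bound on them includes their convergence.

  The sequences \<open>\<nu>\<close> and \<open>a\<close> have index set \<open>{1, 2, \<dots>}\<close>: their value at \<open>0\<close> is never used, and the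
  series over \<open>n \<ge> 1\<close> are written \<open>\<Sum>n. t (Suc n)\<close>.
\<close>

definition csch :: "real \<Rightarrow> real" where
  "csch u = 2 / (exp u - exp (- u))"

definition V :: "(nat \<Rightarrow> real) \<Rightarrow> nat \<Rightarrow> real" where
  "V \<nu> n = (\<Sum>j=1..n. \<nu> j)"

definition U :: "(real \<Rightarrow> real) \<Rightarrow> real \<Rightarrow> real" where
  "U \<mu> x = integral\<^sup>L (lebesgue_on {0<..x}) \<mu>"

definition hardy_kernel ::
  "real \<Rightarrow> real \<Rightarrow> real \<Rightarrow> real \<Rightarrow> real \<Rightarrow> (real \<Rightarrow> real) \<Rightarrow> (nat \<Rightarrow> real) \<Rightarrow> real \<Rightarrow> nat \<Rightarrow> real"
where
  "hardy_kernel \<alpha> \<rho> \<gamma> \<beta> \<delta> \<mu> \<nu> x n =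
     csch (\<rho> * U \<mu> x powr (\<delta> * \<gamma>) * (V \<nu> n - \<beta>) powr \<gamma>)
       / exp (\<alpha> * U \<mu> x powr (\<delta> * \<gamma>) * (V \<nu> n - \<beta>) powr \<gamma>)"

definition kconst :: "real \<Rightarrow> real \<Rightarrow> real \<Rightarrow> real \<Rightarrow> real" where
  "kconst \<alpha> \<rho> \<gamma> \<sigma> =
     (LINT t|lebesgue_on {0<..}.
        csch (\<rho> * t powr \<gamma>) / exp (\<alpha> * t powr \<gamma>) * t powr (\<sigma> - 1))"

text \<open>Real powers on \<open>[0,\<infinity>]\<close>; only meant for exponents \<open>s > 0\<close>, where \<open>\<infinity>\<^sup>s = \<infinity>\<close> and \<open>0\<^sup>s = 0\<close>.\<close>

definition epowr :: "ennreal \<Rightarrow> real \<Rightarrow> ennreal" where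
  "epowr x s = (if x = \<infinity> then \<infinity> else ennreal (enn2real x powr s))"

definition \<Phi> :: "real \<Rightarrow> real \<Rightarrow> real \<Rightarrow> (real \<Rightarrow> real) \<Rightarrow> real \<Rightarrow> real" where
  "\<Phi> p \<sigma> \<delta> \<mu> x = U \<mu> x powr (p * (1 - \<delta> * \<sigma>) - 1) / \<mu> x powr (p - 1)"

definition \<Psi> :: "real \<Rightarrow> real \<Rightarrow> real \<Rightarrow> (nat \<Rightarrow> real) \<Rightarrow> nat \<Rightarrow> real" where
  "\<Psi> q \<sigma> \<beta> \<nu> n = (V \<nu> n - \<beta>) powr (q * (1 - \<sigma>) - 1) / \<nu> (Suc n) powr (q - 1)"

definition fun_norm :: "real \<Rightarrow> (real \<Rightarrow> real) \<Rightarrow> (real \<Rightarrow> real) \<Rightarrow> ennreal" where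
  "fun_norm p w f =
     epowr (\<integral>\<^sup>+x. ennreal (w x * f x powr p) \<partial>lebesgue_on {0<..}) (1 / p)"

definition seq_norm :: "real \<Rightarrow> (nat \<Rightarrow> real) \<Rightarrow> (nat \<Rightarrow> real) \<Rightarrow> ennreal" where
  "seq_norm q w a =
     epowr (\<Sum>n. ennreal (w (Suc n) * a (Suc n) powr q)) (1 / q)"

definition admissible_fun :: "real \<Rightarrow> (real \<Rightarrow> real) \<Rightarrow> (real \<Rightarrow> real) \<Rightarrow> bool" where
  "admissible_fun p w f \<longleftrightarrow>
     f \<in> borel_measurable (lebesgue_on {0<..}) \<and> (\<forall>x>0. 0 \<le> f x) \<and>
     0 < fun_norm p w f \<and> fun_norm p w f < \<infinity>"

definition admissible_seq :: "real \<Rightarrow> (nat \<Rightarrow> real) \<Rightarrow> (nat \<Rightarrow> real) \<Rightarrow> bool" where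
  "admissible_seq q w a \<longleftrightarrow>
     (\<forall>n\<ge>1. 0 \<le> a n) \<and> 0 < seq_norm q w a \<and> seq_norm q w a < \<infinity>"

definition best_constant :: "(real \<Rightarrow> bool) \<Rightarrow> real \<Rightarrow> bool" where
  "best_constant P k \<longleftrightarrow> P k \<and> (\<forall>c. 0 < c \<and> c < k \<longrightarrow> \<not> P c)"

end

theory Submission
  imports Defs
begin

text \<open>
  Write \<open>h t = csch (\<rho> t\<^sup>\<gamma>) / exp (\<alpha> t\<^sup>\<gamma>)\<close>, so that the kernel is \<open>h (U(x)\<^sup>\<delta> (V\<^sub>n - \<beta>))\<close>. Substituting
  \<open>t = U(x)\<^sup>\<delta> (V\<^sub>n - \<beta>)\<close>, the integral of the kernel against \<open>\<mu> U powr (\<delta>\<sigma> - 1)\<close> is exactly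
  \<open>k(\<sigma>) (V\<^sub>n - \<beta>) powr (- \<sigma>)\<close>. Its sum against \<open>\<nu>\<^sub>n\<^sub>+\<^sub>1 (V\<^sub>n - \<beta>) powr (\<sigma> - 1)\<close> is strictly less than
  \<open>k(\<sigma>) U(x) powr (- \<delta>\<sigma>)\<close>, because \<open>h t * t powr (\<sigma> - 1)\<close> is strictly convex and midpoint sums of a
  strictly convex function lie below its integral. With these two weights, Hoelder's inequality for
  each \<open>n\<close> (respectively each \<open>x\<close>) and Tonelli give the second and third inequality, and each of
  these, again by Hoelder, bounds the bilinear form of the first one. Hence it suffices to
  show optimality for the bilinear form, where truncated extremal functions have a ratio that
  tends to \<open>k(\<sigma>)\<close>, since the logarithm of \<open>V\<^sub>n - \<beta>\<close> is unbounded.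
\<close>

section \<open>Powers and the Hoelder inequality in the extended half-line\<close>

text \<open>Convexity does not pass to products, so it is not carried alone. Clearing the
  denominator of csch splits the kernel into
  \<open>exp (- (\<alpha> + \<rho>) t powr \<gamma>)\<close> and
  \<open>1 / (1 - exp (- 2 \<rho> t powr \<gamma>))\<close>, up to a factor 2; these and
  \<open>t powr (\<sigma> - 1)\<close> are positive, decreasing and convex at once, a class closed
  under products. Concavity of \<open>t powr \<gamma>\<close> comes from \<gamma> < \<sigma> \<le>
  1; the singularity of order \<open>t powr (- \<gamma>)\<close> at 0 asks for \<gamma> < \<sigma>,
  and \<rho> > - \<alpha> gives decay at infinity. The integral weight is an identity, so strictness
  in the second and third inequality comes from the discrete weight alone. For optimality let S be
  the truncated sum of \<open>\<nu>\<^sub>n\<^sub>+\<^sub>1 / (V\<^sub>n - \<beta>)\<close> and D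
  the logarithmic length of the window of the test function. The bilinear form is at least d S for
  any prescribed d < k(\<sigma>), while the norms are \<open>D powr (1 / p)\<close> and
  \<open>S powr (1 / q)\<close>; it remains to bring D / S below a given number greater than 1.
  Cutting off the extremal powers, instead of perturbing their exponents, makes the norms a
  logarithm and a finite sum.\<close>

lemma epowr_ennreal [simp]: "0 \<le> r \<Longrightarrow> epowr (ennreal r) s = ennreal (r powr s)"
  by (simp add: epowr_def)

lemma epowr_top [simp]: "epowr top s = top"
  by (simp add: epowr_def infinity_ennreal_def)

lemma epowr_0 [simp]: "epowr 0 s = 0"
  by (simp add: epowr_def)

lemma epowr_1 [simp]: "epowr x 1 = x"
  by (cases x) auto

lemma epowr_eq_0_iff [simp]: "epowr x s = 0 \<longleftrightarrow> x = 0"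
  by (cases x) auto

lemma epowr_eq_top_iff [simp]: "epowr x s = top \<longleftrightarrow> x = top"
  by (cases x) auto

lemma epowr_mult:
  assumes "0 < s"
  shows "epowr (x * y) s = epowr x s * epowr y s"
  by (cases x; cases y)
    (auto simp: ennreal_mult_top ennreal_top_mult powr_mult simp flip: ennreal_mult)

lemma epowr_epowr: "epowr (epowr x s) t = epowr x (s * t)"
  by (cases x) (auto simp: powr_powr)

lemma epowr_add:
  assumes "0 < s" "0 < t"
  shows "epowr x s * epowr x t = epowr x (s + t)"
  using assms by (cases x) (auto simp: powr_add simp flip: ennreal_mult)

lemma epowr_mono: "x \<le> y \<Longrightarrow> 0 < s \<Longrightarrow> epowr x s \<le> epowr y s"
  by (cases x; cases y) (auto simp: powr_mono2 top_unique)

lemma epowr_strict_mono: "x < y \<Longrightarrow> 0 < s \<Longrightarrow> epowr x s < epowr y s"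
  by (cases x; cases y) (auto simp: powr_less_mono2 ennreal_less_iff)

lemma epowr_root_less:
  assumes "x < epowr y p" "0 < p"
  shows "epowr x (1 / p) < y"
  using epowr_strict_mono[of x "epowr y p" "1 / p"] assms by (simp add: epowr_epowr)

lemma borel_measurable_epowr [measurable]:
  assumes [measurable]: "f \<in> borel_measurable M"
  shows "(\<lambda>x. epowr (f x) s) \<in> borel_measurable M"
  unfolding epowr_def by measurable

lemma epowr_Young:
  assumes "1 < p" "1 < q" "1 / p + 1 / q = 1"
  shows "x * y \<le> ennreal (1 / p) * epowr x p + ennreal (1 / q) * epowr y q"
proof (cases "x = top \<or> y = top")
  case True
  then show ?thesis
    using assms by (cases "x = top"; cases "y = top") (auto simp: ennreal_mult_top)
next
  case False
  then obtain r s where "x = ennreal r" "0 \<le> r" "y = ennreal s" "0 \<le> s"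
    by (cases x; cases y) auto
  then show ?thesis
    using Youngs_inequality[OF assms, of r s] assms
    by (simp flip: ennreal_mult ennreal_plus)
qed

text \<open>If both norms are positive and finite, dividing by them reduces the claim to an
  integrated Young inequality, where 1/p + 1/q = 1 gives the constant 1. A zero norm makes the
  product vanish almost everywhere; otherwise an infinite norm makes the right side
  \<open>top\<close>.\<close>

lemma nn_integral_Holder:
  fixes f g :: "'a \<Rightarrow> ennreal"
  assumes [measurable]: "f \<in> borel_measurable M" "g \<in> borel_measurable M"
    and pq: "1 < p" "1 < q" "1 / p + 1 / q = 1"
  shows "(\<integral>\<^sup>+x. f x * g x \<partial>M) \<le>
    epowr (\<integral>\<^sup>+x. epowr (f x) p \<partial>M) (1 / p) * epowr (\<integral>\<^sup>+x. epowr (g x) q \<partial>M) (1 / q)"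
proof -
  define X where "X = (\<integral>\<^sup>+x. epowr (f x) p \<partial>M)"
  define Y where "Y = (\<integral>\<^sup>+x. epowr (g x) q \<partial>M)"
  have "(\<integral>\<^sup>+x. f x * g x \<partial>M) = 0" if "X = 0 \<or> Y = 0"
  proof -
    have "AE x in M. f x * g x = 0"
      using that
    proof
      assume "X = 0"
      then have "AE x in M. epowr (f x) p = 0"
        unfolding X_def by (subst (asm) nn_integral_0_iff_AE) auto
      then show ?thesis by (auto elim: AE_mp)
    next
      assume "Y = 0"
      then have "AE x in M. epowr (g x) q = 0"
        unfolding Y_def by (subst (asm) nn_integral_0_iff_AE) auto
      then show ?thesis by (auto elim: AE_mp)
    qed
    then show ?thesis by (subst nn_integral_0_iff_AE) auto
  qed
  moreover have "(\<integral>\<^sup>+x. f x * g x \<partial>M) \<le> epowr X (1 / p) * epowr Y (1 / q)"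
    if XY: "X \<noteq> 0" "Y \<noteq> 0" "X \<noteq> top" "Y \<noteq> top"
  proof -
    obtain r where r: "X = ennreal r" "0 < r"
      using XY by (cases X) (auto simp: le_less)
    obtain s where s: "Y = ennreal s" "0 < s"
      using XY by (cases Y) (auto simp: le_less)
    define u where "u = r powr (1 / p)"
    define v where "v = s powr (1 / q)"
    have uv: "0 < u" "0 < v" "u powr p = r" "v powr q = s"
      using pq r s by (auto simp: u_def v_def powr_powr)
    have "f x * g x = ennreal (u * v) * ((ennreal (1 / u) * f x) * (ennreal (1 / v) * g x))" for x
    proof -
      have "ennreal (u * v) * (ennreal (1 / u) * ennreal (1 / v)) = 1"
        using uv by (simp flip: ennreal_mult)
      then show ?thesis by (metis mult.assoc mult.left_commute mult_1)
    qed
    then have "(\<integral>\<^sup>+x. f x * g x \<partial>M) =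
        ennreal (u * v) * (\<integral>\<^sup>+x. (ennreal (1 / u) * f x) * (ennreal (1 / v) * g x) \<partial>M)"
      by (simp add: nn_integral_cmult)
    also have "\<dots> \<le> ennreal (u * v) * (\<integral>\<^sup>+x. ennreal (1 / p) * epowr (ennreal (1 / u) * f x) p
        + ennreal (1 / q) * epowr (ennreal (1 / v) * g x) q \<partial>M)"
      by (intro mult_left_mono nn_integral_mono epowr_Young pq) auto
    also have "\<dots> = ennreal (u * v) * (ennreal (1 / p) * (ennreal (1 / r) * X)
        + ennreal (1 / q) * (ennreal (1 / s) * Y))"
      using pq uv
      by (simp add: nn_integral_add nn_integral_cmult epowr_mult powr_divide X_def Y_def)
    also have "\<dots> = ennreal (u * v) * (ennreal (1 / p) + ennreal (1 / q))"
      using r s by (simp flip: ennreal_mult)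
    also have "\<dots> = ennreal (u * v)"
      using pq by (simp flip: ennreal_plus)
    also have "\<dots> = epowr X (1 / p) * epowr Y (1 / q)"
      using r s by (simp add: u_def v_def ennreal_mult)
    finally show ?thesis .
  qed
  moreover have "epowr X (1 / p) * epowr Y (1 / q) = top"
    if "X \<noteq> 0" "Y \<noteq> 0" "X = top \<or> Y = top"
    using that by (auto simp: ennreal_mult_eq_top_iff)
  ultimately have "(\<integral>\<^sup>+x. f x * g x \<partial>M) \<le> epowr X (1 / p) * epowr Y (1 / q)"
    by (cases "X = 0 \<or> Y = 0"; cases "X = top \<or> Y = top") simp_all
  then show ?thesis by (simp add: X_def Y_def)
qed

text \<open>Hoelder after splitting \<open>w\<close> into its powers 1/p and 1/q, with p/q = p - 1.
  For \<open>w\<close> the kernel times a weight, the total mass of \<open>w\<close> is a weight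
  function; the measure is later Lebesgue as well as counting measure.\<close>

lemma epowr_nn_integral_weighted_le:
  assumes [measurable]: "w \<in> borel_measurable M" "g \<in> borel_measurable M"
    and p: "1 < p"
  shows "epowr (\<integral>\<^sup>+x. w x * g x \<partial>M) p \<le> epowr (\<integral>\<^sup>+x. w x \<partial>M) (p - 1) * (\<integral>\<^sup>+x. w x * epowr (g x) p \<partial>M)"
proof -
  define q where "q = p / (p - 1)"
  have q: "1 < q" "1 / p + 1 / q = 1" "p * (1 / q) = p - 1"
    using p by (auto simp: q_def field_simps)
  have "(\<integral>\<^sup>+x. w x * g x \<partial>M) = (\<integral>\<^sup>+x. (epowr (w x) (1 / p) * g x) * epowr (w x) (1 / q) \<partial>M)"
  proof (rule nn_integral_cong)
    fix x
    have "w x = epowr (w x) (1 / p) * epowr (w x) (1 / q)"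
      using p q by (subst epowr_add) auto
    then show "w x * g x = (epowr (w x) (1 / p) * g x) * epowr (w x) (1 / q)"
      by (metis mult.assoc mult.commute)
  qed
  also have "\<dots> \<le> epowr (\<integral>\<^sup>+x. epowr (epowr (w x) (1 / p) * g x) p \<partial>M) (1 / p)
      * epowr (\<integral>\<^sup>+x. epowr (epowr (w x) (1 / q)) q \<partial>M) (1 / q)"
    using p q by (intro nn_integral_Holder) auto
  also have "\<dots> = epowr (\<integral>\<^sup>+x. w x * epowr (g x) p \<partial>M) (1 / p) * epowr (\<integral>\<^sup>+x. w x \<partial>M) (1 / q)"
    using p q by (simp add: epowr_mult epowr_epowr)
  finally have "epowr (\<integral>\<^sup>+x. w x * g x \<partial>M) p
      \<le> epowr (epowr (\<integral>\<^sup>+x. w x * epowr (g x) p \<partial>M) (1 / p) * epowr (\<integral>\<^sup>+x. w x \<partial>M) (1 / q)) p"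
    using p by (intro epowr_mono) auto
  also have "\<dots> = epowr (\<integral>\<^sup>+x. w x \<partial>M) (p - 1) * (\<integral>\<^sup>+x. w x * epowr (g x) p \<partial>M)"
    using p q by (simp add: epowr_mult epowr_epowr mult.commute)
  finally show ?thesis .
qed

section \<open>Substitution by the primitive\<close>

context
  fixes \<mu> :: "real \<Rightarrow> real"
  assumes cont: "continuous_on {0<..} \<mu>"
    and pos: "\<forall>x>0. 0 < \<mu> x"
    and int: "\<forall>x>0. integrable (lebesgue_on {0<..x}) \<mu>"
begin

text \<open>\<open>\<mu>\<close> is unconstrained at 0 and possibly unbounded nearby. Adding the
  null set {0} to the domain makes the theorems on indefinite integrals over closed intervals
  available for \<open>U\<close>.\<close>

lemma integrable_on_Icc: "\<mu> integrable_on {0..x}"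
proof (cases "0 < x")
  case True
  then have "\<mu> integrable_on {0<..x}"
    using int by (intro integrable_on_lebesgue_on) auto
  moreover have "negligible (sym_diff {0<..x} {0..x})"
    by (rule negligible_subset[of "{0}"]) auto
  ultimately show ?thesis
    using integrable_spike_set_eq by blast
next
  case False
  then show ?thesis using integrable_on_refl[of \<mu> x] by (cases "x = 0") auto
qed

lemma U_eq_integral:
  assumes "0 < x"
  shows "U \<mu> x = integral {0..x} \<mu>"
proof -
  have "U \<mu> x = integral {0<..x} \<mu>"
    unfolding U_def using int assms by (intro lebesgue_integral_eq_integral) auto
  also have "\<dots> = integral {0..x} \<mu>"
    by (rule integral_spike_set; rule negligible_subset[of "{0}"]) auto
  finally show ?thesis .
qed

lemma U_has_real_derivative:
  assumes "0 < x"
  shows "(U \<mu> has_real_derivative \<mu> x) (at x)"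
proof -
  have "((\<lambda>u. integral {0..u} \<mu>) has_vector_derivative \<mu> x) (at x within {0..x + 1})"
    using assms cont integral_has_vector_derivative_continuous_at[OF integrable_on_Icc, of x "x + 1" "{}"]
    by (simp add: continuous_on_eq_continuous_at continuous_at_imp_continuous_at_within)
  then have "((\<lambda>u. integral {0..u} \<mu>) has_real_derivative \<mu> x) (at x)"
    using assms by (simp add: has_real_derivative_iff_has_vector_derivative at_within_Icc_at)
  moreover have "\<forall>\<^sub>F u in nhds x. integral {0..u} \<mu> = U \<mu> u"
    using eventually_nhds_in_open[of "{0<..}" x] assms
    by (auto elim!: eventually_mono simp: U_eq_integral)
  ultimately show ?thesis
    using DERIV_cong_ev[of x x "\<lambda>u. integral {0..u} \<mu>" "U \<mu>" "\<mu> x" "\<mu> x"] by simp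
qed

lemma U_tendsto_0: "(U \<mu> \<longlongrightarrow> 0) (at_right 0)"
proof -
  have "continuous_on {0..1} (\<lambda>x. integral {0..x} \<mu>)"
    by (intro indefinite_integral_continuous_1 integrable_on_Icc)
  then have "((\<lambda>x. integral {0..x} \<mu>) \<longlongrightarrow> 0) (at 0 within {0..1})"
    by (force simp: continuous_on)
  then have "((\<lambda>x. integral {0..x} \<mu>) \<longlongrightarrow> 0) (at_right 0)"
    by (simp add: at_within_Icc_at_right)
  moreover have "\<forall>\<^sub>F x in at_right 0. integral {0..x} \<mu> = U \<mu> x"
    using eventually_at_right_less[of "0::real"] by (rule eventually_mono) (simp add: U_eq_integral)
  ultimately show ?thesis
    by (rule Lim_transform_eventually)
qed

lemma U_strict_mono:
  assumes "0 < x" "x < y"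
  shows "U \<mu> x < U \<mu> y"
proof (rule DERIV_pos_imp_increasing[OF assms(2)])
  fix z assume "x \<le> z" "z \<le> y"
  then have "0 < z" using assms by simp
  then show "\<exists>d. (U \<mu> has_real_derivative d) (at z) \<and> 0 < d"
    using U_has_real_derivative[of z] pos by blast
qed

lemma U_gt_0:
  assumes "0 < x"
  shows "0 < U \<mu> x"
proof -
  have "0 \<le> U \<mu> (x / 2)"
    unfolding U_def using pos
    by (intro integral_nonneg_AE AE_I2) (auto simp: space_restrict_space intro: less_imp_le)
  also have "\<dots> < U \<mu> x" using assms by (intro U_strict_mono) auto
  finally show ?thesis .
qed

lemma continuous_on_U: "continuous_on {0<..} (U \<mu>)"
  by (rule continuous_at_imp_continuous_on) (use U_has_real_derivative DERIV_isCont in blast)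

text \<open>Intermediate value theorem between a point near 0, where \<open>U\<close> is small, and
  a distant one. Unboundedness of \<open>U\<close> enters here and lets the substitution cover the
  whole half-line.\<close>

lemma U_image:
  assumes "filterlim (U \<mu>) at_top at_top"
  shows "U \<mu> ` {0<..} = {0<..}"
proof (intro equalityI subsetI)
  fix y :: real assume "y \<in> {0<..}"
  then have y: "0 < y" by simp
  have "\<forall>\<^sub>F x in at_right 0. U \<mu> x < y"
    using U_tendsto_0 y by (rule order_tendstoD)
  moreover have "\<forall>\<^sub>F x in at_right 0. (0::real) < x"
    by (rule eventually_at_right_less)
  ultimately have "\<forall>\<^sub>F x in at_right 0. 0 < x \<and> U \<mu> x < y"
    by eventually_elim auto
  then obtain a where a: "0 < a" "U \<mu> a < y"
    using eventually_happens by force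
  have "\<forall>\<^sub>F x in at_top. y \<le> U \<mu> x"
    using assms by (simp add: filterlim_at_top)
  moreover have "\<forall>\<^sub>F x in at_top. a \<le> x" by (rule eventually_ge_at_top)
  ultimately have "\<forall>\<^sub>F x in at_top. a \<le> x \<and> y \<le> U \<mu> x" by eventually_elim auto
  then obtain b where b: "a \<le> b" "y \<le> U \<mu> b"
    using eventually_happens by force
  have "\<exists>x\<ge>a. x \<le> b \<and> U \<mu> x = y"
    using a b by (intro IVT' continuous_on_subset[OF continuous_on_U]) auto
  then show "y \<in> U \<mu> ` {0<..}" using a by force
qed (auto intro: U_gt_0)

text \<open>The map \<open>c * U \<mu> x powr \<delta>\<close> is a bijection of the half-line,
  decreasing for \<delta> = -1; since \<delta> has absolute value 1, the weight on the left is the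
  absolute value of its derivative. The change of variables concerns absolutely integrable
  functions, hence the hypothesis on \<open>G\<close>.\<close>

lemma nn_integral_substitution_U:
  fixes G :: "real \<Rightarrow> real"
  assumes lim: "filterlim (U \<mu>) at_top at_top"
    and \<delta>: "\<delta> \<in> {-1, 1}" and c: "0 < c"
    and G: "integrable (lebesgue_on {0<..}) G" "\<And>t. 0 < t \<Longrightarrow> 0 \<le> G t"
  shows "(\<integral>\<^sup>+x. ennreal (c * U \<mu> x powr (\<delta> - 1) * \<mu> x * G (c * U \<mu> x powr \<delta>)) \<partial>lebesgue_on {0<..})
    = (\<integral>\<^sup>+t. ennreal (G t) \<partial>lebesgue_on {0<..})"
proof -
  let ?g = "\<lambda>x. c * U \<mu> x powr \<delta>"
  let ?g' = "\<lambda>x. c * (\<delta> * U \<mu> x powr (\<delta> - 1) * \<mu> x)"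
  have inj: "inj_on ?g {0<..}"
  proof (rule inj_onI)
    fix x y :: real
    assume xy: "x \<in> {0<..}" "y \<in> {0<..}" "?g x = ?g y"
    then have "U \<mu> x = U \<mu> y"
      using c \<delta> U_gt_0[of x] U_gt_0[of y] by (auto simp: powr_minus)
    then show "x = y"
      using xy U_strict_mono[of x y] U_strict_mono[of y x] by (cases x y rule: linorder_cases) auto
  qed
  have der: "(?g has_field_derivative ?g' x) (at x within {0<..})" if "x \<in> {0<..}" for x
    using that U_has_real_derivative[of x, THEN has_field_derivative_at_within] U_gt_0[of x]
    by (auto intro!: derivative_eq_intros simp: powr_diff)
  have img: "?g ` {0<..} = {0<..}"
  proof -
    have "?g ` {0<..} = (\<lambda>u. c * u powr \<delta>) ` (U \<mu> ` {0<..})" by (simp add: image_image)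
    also have "\<dots> = (\<lambda>u. c * u powr \<delta>) ` {0<..}" by (simp add: U_image[OF lim])
    also have "\<dots> = {0<..}"
    proof (intro equalityI subsetI)
      fix y :: real assume "y \<in> {0<..}"
      \<comment> \<open>As \<open>\<delta> * \<delta> = 1\<close>, raising to the power \<delta> is
        its own inverse on the positive reals.\<close>
      then have "y = c * ((y / c) powr \<delta>) powr \<delta>" "(y / c) powr \<delta> \<in> {0<..}"
        using c \<delta> by (auto simp: powr_powr)
      then show "y \<in> (\<lambda>u. c * u powr \<delta>) ` {0<..}" by blast
    qed (use c in auto)
    finally show ?thesis .
  qed
  have abs_g': "\<bar>?g' x\<bar> = c * U \<mu> x powr (\<delta> - 1) * \<mu> x" if "0 < x" for x
  proof -
    have "\<bar>\<delta>\<bar> = 1" using \<delta> by auto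
    moreover have "0 < \<mu> x" using pos that by blast
    ultimately have "\<bar>c * (\<delta> * u * \<mu> x)\<bar> = c * \<bar>u\<bar> * \<mu> x" for u
      using c unfolding abs_mult by simp
    from this[of "U \<mu> x powr (\<delta> - 1)"] show ?thesis by simp
  qed
  have S: "{0<..} \<in> sets (lebesgue :: real measure)" by auto
  have Gabs: "G absolutely_integrable_on {0<..}"
    using G by (simp add: integrable_restrict_space set_integrable_def)
  have *: "(\<lambda>x. \<bar>?g' x\<bar> * G (?g x)) absolutely_integrable_on {0<..} \<and>
      integral {0<..} (\<lambda>x. \<bar>?g' x\<bar> * G (?g x)) = integral {0<..} G"
    using has_absolute_integral_change_of_variables_1'[OF S der inj, of G "integral {0<..} G"] Gabs
    unfolding img by blast
  then have i: "integrable (lebesgue_on {0<..}) (\<lambda>x. \<bar>?g' x\<bar> * G (?g x))"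
    by (simp add: integrable_restrict_space set_integrable_def)
  have nonneg: "0 \<le> G (?g x)" if "0 < x" for x
    using that c U_gt_0[of x] by (intro G) auto
  have "(\<integral>\<^sup>+x. ennreal (c * U \<mu> x powr (\<delta> - 1) * \<mu> x * G (?g x)) \<partial>lebesgue_on {0<..})
      = (\<integral>\<^sup>+x. ennreal (\<bar>?g' x\<bar> * G (?g x)) \<partial>lebesgue_on {0<..})"
    by (intro nn_integral_cong) (simp add: abs_g' space_restrict_space)
  also have "\<dots> = ennreal (LINT x|lebesgue_on {0<..}. \<bar>?g' x\<bar> * G (?g x))"
    using nonneg by (intro nn_integral_eq_integral[OF i] AE_I2) (auto simp: space_restrict_space)
  also have "\<dots> = ennreal (LINT x|lebesgue_on {0<..}. G x)"
    using * i G by (simp add: lebesgue_integral_eq_integral[OF _ S])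
  also have "\<dots> = (\<integral>\<^sup>+t. ennreal (G t) \<partial>lebesgue_on {0<..})"
    using G(2) by (intro nn_integral_eq_integral[OF G(1), symmetric] AE_I2)
      (auto simp: space_restrict_space)
  finally show ?thesis .
qed

end

section \<open>Convexity and integrability of the kernel\<close>

lemma borel_measurable_lebesgue_on:
  assumes "f \<in> borel_measurable borel"
  shows "f \<in> borel_measurable (lebesgue_on S)"
  using assms by (intro measurable_restrict_space1 measurable_completion) simp

definition Kfun :: "real \<Rightarrow> real \<Rightarrow> real \<Rightarrow> real \<Rightarrow> real" where
  "Kfun \<alpha> \<rho> \<gamma> t = csch (\<rho> * t powr \<gamma>) / exp (\<alpha> * t powr \<gamma>)"

text \<open>Numerator and denominator of csch are multiplied by
  \<open>exp (- \<rho> t powr \<gamma>)\<close>. The second factor then carries the singularity at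
  0, the first the decay at infinity.\<close>

lemma Kfun_eq:
  assumes "0 < \<rho>" "0 < t"
  shows "Kfun \<alpha> \<rho> \<gamma> t = 2 * (exp (- ((\<alpha> + \<rho>) * t powr \<gamma>)) * inverse (1 - exp (- (2 * \<rho> * t powr \<gamma>))))"
proof -
  define E where "E = exp (\<rho> * t powr \<gamma>)"
  define A where "A = exp (\<alpha> * t powr \<gamma>)"
  have E: "1 < E" and A: "0 < A" using assms by (auto simp: E_def A_def)
  have "exp (- ((\<alpha> + \<rho>) * t powr \<gamma>)) = inverse A * inverse E"
    by (simp add: E_def A_def exp_minus[symmetric] algebra_simps flip: exp_add)
  moreover have "exp (- (2 * \<rho> * t powr \<gamma>)) = inverse E * inverse E"
    by (simp add: E_def exp_minus[symmetric] algebra_simps flip: exp_add)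
  moreover have "Kfun \<alpha> \<rho> \<gamma> t = 2 / (E - inverse E) / A"
    by (simp add: Kfun_def csch_def E_def A_def exp_minus)
  moreover have "2 / (E - inverse E) / A = 2 * (inverse A * inverse E * inverse (1 - inverse E * inverse E))"
  proof -
    have "E * E > 1 * 1" using E by (intro mult_strict_mono) auto
    then have "E * E - 1 \<noteq> 0" by simp
    then show ?thesis using E A by (simp add: divide_simps)
  qed
  ultimately show ?thesis by simp
qed

text \<open>Convexity at midpoints is what averaging with a reflection consumes. Positivity and
  monotonicity are included because they make the class closed under products; monotonicity is weak
  so that \<open>t powr (\<sigma> - 1)\<close> belongs to it also for \<sigma> = 1.\<close>

definition decr_midconvex :: "(real \<Rightarrow> real) \<Rightarrow> bool" where
  "decr_midconvex f \<longleftrightarrow> (\<forall>x>0. \<forall>y>0. 0 < f x \<and> (x < y \<longrightarrow> f y \<le> f x) \<and> 2 * f ((x + y) / 2) \<le> f x + f y)"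

definition strict_decr :: "(real \<Rightarrow> real) \<Rightarrow> bool" where
  "strict_decr f \<longleftrightarrow> (\<forall>x>0. \<forall>y>x. f y < f x)"

lemma decr_midconvexI:
  assumes "\<And>x. 0 < x \<Longrightarrow> 0 < f x" "\<And>x y. 0 < x \<Longrightarrow> x < y \<Longrightarrow> f y \<le> f x"
    "\<And>x y. 0 < x \<Longrightarrow> 0 < y \<Longrightarrow> 2 * f ((x + y) / 2) \<le> f x + f y"
  shows "decr_midconvex f"
  using assms by (simp add: decr_midconvex_def)

text \<open>The products below are controlled by Chebyshev's sum inequality \<open>0 \<le> (f x - f y) * (g x - g y)\<close>;
  strict monotonicity of both factors, rather than strict convexity, makes the result strict.\<close>

lemma decr_midconvex_mult:
  assumes f: "decr_midconvex f" and g: "decr_midconvex g"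
  shows "decr_midconvex (\<lambda>x. f x * g x)"
proof (rule decr_midconvexI)
  fix x y :: real assume xy: "0 < x" "0 < y"
  let ?m = "(x + y) / 2"
  have "(2 * f ?m) * (2 * g ?m) \<le> (f x + f y) * (g x + g y)"
    using f g xy by (intro mult_mono) (auto simp: decr_midconvex_def intro: less_imp_le add_pos_pos)
  moreover have "0 \<le> (f x - f y) * (g x - g y)"
    using f g xy
    by (cases x y rule: linorder_cases)
      (auto simp: decr_midconvex_def intro: mult_nonpos_nonpos mult_nonneg_nonneg)
  ultimately show "2 * (f ?m * g ?m) \<le> f x * g x + f y * g y"
    by (simp add: algebra_simps)
next
  fix x y :: real assume xy: "0 < x" "x < y"
  then show "f y * g y \<le> f x * g x"
    using f g by (intro mult_mono) (auto simp: decr_midconvex_def intro: less_imp_le)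
qed (use f g in \<open>auto simp: decr_midconvex_def\<close>)

lemma strict_decr_midconvex_mult:
  assumes f: "decr_midconvex f" "strict_decr f" and g: "decr_midconvex g" "strict_decr g"
    and xy: "0 < x" "x < y"
  shows "2 * (f ((x + y) / 2) * g ((x + y) / 2)) < f x * g x + f y * g y"
proof -
  let ?m = "(x + y) / 2"
  have y: "0 < y" using xy by simp
  have "(2 * f ?m) * (2 * g ?m) \<le> (f x + f y) * (g x + g y)"
    using f g xy y by (intro mult_mono) (auto simp: decr_midconvex_def intro!: less_imp_le add_pos_pos)
  moreover have "0 < (f x - f y) * (g x - g y)"
    using f g xy by (intro mult_pos_pos) (auto simp: strict_decr_def)
  ultimately show ?thesis
    by (simp add: algebra_simps)
qed

text \<open>The graph lies below its tangent at the midpoint \<open>m\<close>, which is Bernoulli's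
  inequality for \<open>z / m\<close>, obtained from Young's. Adding the bounds for \<open>x\<close>
  and \<open>y\<close> cancels the linear terms.\<close>

lemma powr_midconcave:
  fixes x y g :: real
  assumes "0 < g" "g \<le> 1" "0 < x" "0 < y"
  shows "x powr g + y powr g \<le> 2 * ((x + y) / 2) powr g"
proof -
  define m where "m = (x + y) / 2"
  have m: "0 < m" using assms by (simp add: m_def)
  have *: "z powr g \<le> m powr g * (1 + g * (z / m - 1))" if "0 < z" for z
  proof -
    have "z powr g = m powr g * (z / m) powr g"
      using that m by (simp add: powr_divide)
    moreover have "(z / m) powr g \<le> 1 + g * (z / m - 1)"
      using Youngs_inequality_0[of g "1 - g" "z / m" 1] assms that m by (simp add: algebra_simps)
    ultimately show ?thesis by (simp add: mult_left_mono)
  qed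
  have "x powr g + y powr g \<le> m powr g * (2 + g * ((x + y) / m - 2))"
    using *[of x] *[of y] assms by (simp add: algebra_simps add_divide_distrib)
  also have "(x + y) / m = 2" using m by (simp add: m_def divide_eq_eq)
  finally show ?thesis by (simp add: m_def mult.commute)
qed

lemma exp_midconvex:
  fixes a b :: real
  shows "2 * exp ((a + b) / 2) \<le> exp a + exp b"
proof -
  have "0 \<le> (exp (a / 2) - exp (b / 2))\<^sup>2" by simp
  also have "\<dots> = exp a + exp b - 2 * exp ((a + b) / 2)"
    by (simp add: power2_eq_square algebra_simps add_divide_distrib flip: exp_add)
  finally show ?thesis by simp
qed

text \<open>Convexity and monotonicity of the reciprocal combined: \<open>c\<close> need only
  dominate the mean, as it does when \<open>a\<close>, \<open>b\<close>, \<open>c\<close> are the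
  values of a concave function at two points and their midpoint.\<close>

lemma inverse_midconvex:
  fixes a b c :: real
  assumes "0 < a" "0 < b" "a + b \<le> 2 * c"
  shows "2 * inverse c \<le> inverse a + inverse b"
proof -
  have c: "0 < c" using assms by linarith
  have "2 * inverse c \<le> 2 * inverse ((a + b) / 2)"
    using assms by (intro mult_left_mono le_imp_inverse_le) auto
  also have "\<dots> = 4 / (a + b)" by (simp add: field_simps)
  also have "\<dots> \<le> inverse a + inverse b"
  proof -
    have "4 * (a * b) \<le> (a + b) * (a + b)"
      using sum_squares_bound[of a b] by (simp add: algebra_simps power2_eq_square)
    then show ?thesis using assms by (simp add: field_simps)
  qed
  finally show ?thesis .
qed

section \<open>Midpoint convexity of the factors of the kernel\<close>

context
  fixes a g :: real
  assumes a: "0 < a" and g: "0 < g" "g \<le> 1"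
begin

lemma exp_powr_strict_decr: "strict_decr (\<lambda>t. exp (- (a * t powr g)))"
  using a g by (auto simp: strict_decr_def powr_less_mono2)

lemma exp_powr_midconvex:
  assumes "0 < x" "0 < y"
  shows "2 * exp (- (a * ((x + y) / 2) powr g)) \<le> exp (- (a * x powr g)) + exp (- (a * y powr g))"
proof -
  have "a * (x powr g + y powr g) \<le> a * (2 * ((x + y) / 2) powr g)"
    using a powr_midconcave[OF g assms] by (intro mult_left_mono) auto
  then have "exp (- (a * ((x + y) / 2) powr g)) \<le> exp ((- (a * x powr g) + - (a * y powr g)) / 2)"
    by (simp add: algebra_simps)
  then show ?thesis
    using exp_midconvex[of "- (a * x powr g)" "- (a * y powr g)"] by linarith
qed

lemma exp_powr_decr_midconvex: "decr_midconvex (\<lambda>t. exp (- (a * t powr g)))"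
  using a g exp_powr_midconvex by (intro decr_midconvexI) (auto simp: powr_mono2)

lemma inverse_exp_powr_strict_decr: "strict_decr (\<lambda>t. inverse (1 - exp (- (a * t powr g))))"
  unfolding strict_decr_def
proof (intro allI impI less_imp_inverse_less)
  fix x y :: real assume xy: "0 < x" "x < y"
  then show "1 - exp (- (a * x powr g)) < 1 - exp (- (a * y powr g))"
    using a g by (auto simp: powr_less_mono2)
  show "0 < 1 - exp (- (a * x powr g))"
    using a xy by auto
qed

text \<open>By \<open>exp_powr_midconvex\<close> the denominator is midpoint concave, so
  \<open>inverse_midconvex\<close> applies.\<close>

lemma inverse_exp_powr_decr_midconvex:
  "decr_midconvex (\<lambda>t. inverse (1 - exp (- (a * t powr g))))"
proof (rule decr_midconvexI)
  fix x y :: real assume xy: "0 < x" "0 < y"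
  show "2 * inverse (1 - exp (- (a * ((x + y) / 2) powr g))) \<le>
    inverse (1 - exp (- (a * x powr g))) + inverse (1 - exp (- (a * y powr g)))"
    using a xy exp_powr_midconvex[OF xy] by (intro inverse_midconvex) auto
next
  fix x y :: real assume "0 < x" "x < y"
  then show "inverse (1 - exp (- (a * y powr g))) \<le> inverse (1 - exp (- (a * x powr g)))"
    using inverse_exp_powr_strict_decr by (auto simp: strict_decr_def intro: less_imp_le)
qed (use a in auto)

end

text \<open>The reciprocal of the concave function \<open>t powr (1 - s)\<close>. The case s = 1 is
  separate because the concavity lemma asks for a positive exponent.\<close>

lemma powr_decr_midconvex:
  assumes "0 < s" "s \<le> 1"
  shows "decr_midconvex (\<lambda>t. t powr (s - 1))"
proof (cases "s = 1")
  case True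
  then show ?thesis by (simp add: decr_midconvex_def)
next
  case False
  have eq: "t powr (s - 1) = inverse (t powr (1 - s))" for t :: real
    by (simp flip: powr_minus)
  show ?thesis
    unfolding eq
  proof (rule decr_midconvexI)
    fix x y :: real assume xy: "0 < x" "0 < y"
    then show "2 * inverse (((x + y) / 2) powr (1 - s)) \<le> inverse (x powr (1 - s)) + inverse (y powr (1 - s))"
      using False assms by (intro inverse_midconvex powr_midconcave) auto
  next
    fix x y :: real assume xy: "0 < x" "x < y"
    then show "inverse (y powr (1 - s)) \<le> inverse (x powr (1 - s))"
      using False assms by (intro le_imp_inverse_le powr_mono2) auto
  qed auto
qed

lemma Kfun_pos:
  assumes "0 < \<rho>" "0 < t"
  shows "0 < Kfun \<alpha> \<rho> \<gamma> t"
  using assms by (simp add: Kfun_eq)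

text \<open>For \<sigma> = 1 the power is constant, so strictness must not rest on it. It is
  absorbed into \<open>g\<close>, which is strictly decreasing through \<open>h\<close>; with the
  exponential \<open>f\<close> this gives two strictly decreasing factors.\<close>

lemma Kfun_powr_strict_midconvex:
  assumes "0 < \<rho>" "0 < \<alpha> + \<rho>" "0 < \<gamma>" "\<gamma> < \<sigma>" "\<sigma> \<le> 1" "0 < x" "x < y"
  shows "2 * (Kfun \<alpha> \<rho> \<gamma> ((x + y) / 2) * ((x + y) / 2) powr (\<sigma> - 1))
    < Kfun \<alpha> \<rho> \<gamma> x * x powr (\<sigma> - 1) + Kfun \<alpha> \<rho> \<gamma> y * y powr (\<sigma> - 1)"
proof -
  define f where "f t = exp (- ((\<alpha> + \<rho>) * t powr \<gamma>))" for t
  define h where "h t = inverse (1 - exp (- (2 * \<rho> * t powr \<gamma>)))" for t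
  define g where "g t = h t * t powr (\<sigma> - 1)" for t
  have h: "decr_midconvex h" "strict_decr h"
    unfolding h_def
    using assms inverse_exp_powr_decr_midconvex[of "2 * \<rho>" \<gamma>]
      inverse_exp_powr_strict_decr[of "2 * \<rho>" \<gamma>] by auto
  have p: "decr_midconvex (\<lambda>t. t powr (\<sigma> - 1))"
    using assms by (intro powr_decr_midconvex) auto
  have f: "decr_midconvex f" "strict_decr f"
    unfolding f_def using assms by (auto intro: exp_powr_decr_midconvex exp_powr_strict_decr)
  have "decr_midconvex g"
    unfolding g_def by (intro decr_midconvex_mult h p)
  moreover have "strict_decr g"
    unfolding strict_decr_def
  proof (intro allI impI)
    fix u v :: real assume uv: "0 < u" "u < v"
    have "h v * v powr (\<sigma> - 1) < h u * v powr (\<sigma> - 1)"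
      using h uv by (intro mult_strict_right_mono) (auto simp: strict_decr_def)
    also have "\<dots> \<le> h u * u powr (\<sigma> - 1)"
      using h p uv by (intro mult_left_mono) (auto simp: decr_midconvex_def intro: less_imp_le)
    finally show "g v < g u" by (simp add: g_def)
  qed
  ultimately have "2 * (f ((x + y) / 2) * g ((x + y) / 2)) < f x * g x + f y * g y"
    using f assms by (intro strict_decr_midconvex_mult)
  moreover have "Kfun \<alpha> \<rho> \<gamma> t * t powr (\<sigma> - 1) = 2 * (f t * g t)" if "0 < t" for t
    using that assms by (simp add: Kfun_eq f_def g_def h_def)
  ultimately show ?thesis
    using assms by simp
qed

section \<open>Integrability of the kernel against a power\<close>

lemma borel_measurable_Kfun [measurable]: "Kfun \<alpha> \<rho> \<gamma> \<in> borel_measurable borel"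
  unfolding Kfun_def[abs_def] csch_def by measurable

lemma exp_minus_le_power:
  fixes v :: real
  assumes "0 < v" "0 < n"
  shows "exp (- v) \<le> real n ^ n / v ^ n"
proof -
  have "(v / n) ^ n \<le> (1 + v / n) ^ n"
    using assms by (intro power_mono) auto
  also have "\<dots> \<le> exp v"
    using assms by (intro exp_ge_one_plus_x_over_n_power_n) auto
  finally show ?thesis using assms by (simp add: exp_minus power_divide field_simps)
qed

lemma integrable_exp_powr:
  fixes a g s :: real
  assumes a: "0 < a" and g: "0 < g" and s: "0 < s"
  shows "integrable (lebesgue_on {0<..}) (\<lambda>t. exp (- (a * t powr g)) * t powr (s - 1))"
proof -
  \<comment> \<open>With \<open>n * g\<close> at least \<open>s + 1\<close>, the bound of order
    \<open>n\<close> for the exponential leaves at most a multiple of \<open>t powr (-2)\<close>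
    when t \<ge> 1.\<close>
  define n where "n = nat \<lceil>(s + 1) / g\<rceil>"
  have n: "s + 1 \<le> real n * g"
    using g unfolding n_def by (simp add: field_simps) (metis le_of_int_ceiling pos_divide_le_eq of_nat_0_le_iff real_nat_ceiling_ge mult.commute)
  have n0: "0 < n" using n s by (cases n) auto
  define C where "C = real n ^ n / a ^ n"
  have C: "0 < C" using a n0 by (simp add: C_def)
  define B where "B t = indicator {0..1} t * t powr (s - 1) + C * (indicator {1..} t * t powr (-2))" for t :: real
  have "set_integrable lebesgue {0..1} (\<lambda>t. t powr (s - 1))"
    using s has_integral_powr_from_0[of "s - 1" 1]
    by (intro nonnegative_absolutely_integrable_1) (auto simp: integrable_on_def)
  moreover have "set_integrable lebesgue {1..} (\<lambda>t::real. t powr (-2))"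
    using has_integral_powr_to_inf[of "-2" 1]
    by (intro nonnegative_absolutely_integrable_1) (auto simp: integrable_on_def)
  ultimately have B: "integrable lebesgue B"
    unfolding B_def[abs_def]
    by (intro Bochner_Integration.integrable_add integrable_mult_right) (simp_all add: set_integrable_def)
  then have B: "integrable (lebesgue_on {0<..}) B"
    using integrable_mult_indicator[of "{0<..}" lebesgue B] by (subst integrable_restrict_space) auto
  show ?thesis
  proof (rule Bochner_Integration.integrable_bound[OF B])
    show "AE t in lebesgue_on {0<..}. norm (exp (- (a * t powr g)) * t powr (s - 1)) \<le> norm (B t)"
    proof (rule AE_I2)
      fix t :: real assume "t \<in> space (lebesgue_on {0<..})"
      then have t: "0 < t" by (simp add: space_restrict_space)
      have "exp (- (a * t powr g)) * t powr (s - 1) \<le> B t"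
      proof (cases "t \<le> 1")
        case True
        have "exp (- (a * t powr g)) * t powr (s - 1) \<le> 1 * t powr (s - 1)"
          using a by (intro mult_right_mono) auto
        also have "\<dots> \<le> B t" using True t C by (simp add: B_def)
        finally show ?thesis .
      next
        case False
        have "exp (- (a * t powr g)) \<le> real n ^ n / (a * t powr g) ^ n"
          using a t n0 by (intro exp_minus_le_power) auto
        also have "\<dots> = C * t powr (- (real n * g))"
          using a t by (simp add: C_def power_mult_distrib powr_power powr_minus field_simps)
        also have "\<dots> \<le> C * t powr (- (s + 1))"
          using C t n False by (intro mult_left_mono powr_mono) auto
        finally have "exp (- (a * t powr g)) * t powr (s - 1) \<le> C * t powr (- (s + 1)) * t powr (s - 1)"
          by (intro mult_right_mono) auto
        also have "\<dots> = C * t powr (-2)"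
          by (simp add: mult.assoc flip: powr_add)
        also have "\<dots> = B t" using False by (simp add: B_def)
        finally show ?thesis .
      qed
      then show "norm (exp (- (a * t powr g)) * t powr (s - 1)) \<le> norm (B t)"
        by simp
    qed
  qed (intro borel_measurable_lebesgue_on, measurable)
qed

text \<open>\<open>1 + v \<le> exp v\<close> yields
  \<open>1 / (1 - exp (- v)) \<le> 1 + 1 / v\<close>. The term \<open>1 / v\<close> costs a factor
  \<open>t powr (- \<gamma>)\<close>, and \<gamma> < \<sigma> keeps the resulting exponent above
  -1.\<close>

lemma integrable_Kfun_powr:
  assumes "0 < \<rho>" "0 < \<alpha> + \<rho>" "0 < \<gamma>" "\<gamma> < \<sigma>"
  shows "integrable (lebesgue_on {0<..}) (\<lambda>t. Kfun \<alpha> \<rho> \<gamma> t * t powr (\<sigma> - 1))"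
proof -
  let ?E = "\<lambda>s t. exp (- ((\<alpha> + \<rho>) * t powr \<gamma>)) * t powr (s - 1)"
  let ?B = "\<lambda>t. 2 * ?E \<sigma> t + 1 / \<rho> * ?E (\<sigma> - \<gamma>) t"
  have B: "integrable (lebesgue_on {0<..}) ?B"
    using assms by (intro Bochner_Integration.integrable_add integrable_mult_right integrable_exp_powr) auto
  show ?thesis
  proof (rule Bochner_Integration.integrable_bound[OF B])
    show "AE t in lebesgue_on {0<..}. norm (Kfun \<alpha> \<rho> \<gamma> t * t powr (\<sigma> - 1)) \<le> norm (?B t)"
    proof (rule AE_I2)
      fix t :: real assume "t \<in> space (lebesgue_on {0<..})"
      then have t: "0 < t" by (simp add: space_restrict_space)
      define v where "v = 2 * \<rho> * t powr \<gamma>"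
      have v: "0 < v" using assms t by (simp add: v_def)
      have "1 + v \<le> exp v" by simp
      then have "exp (- v) \<le> inverse (1 + v)"
        using v by (simp add: exp_minus)
      moreover have "v / (1 + v) = 1 - inverse (1 + v)"
        using v by (simp add: field_simps)
      ultimately have "inverse (1 - exp (- v)) \<le> inverse (v / (1 + v))"
        using v by (intro le_imp_inverse_le divide_pos_pos) auto
      also have "\<dots> = 1 + 1 / v" using v by (simp add: add_divide_distrib)
      also have "1 / v = 1 / (2 * \<rho>) * t powr (- \<gamma>)"
        by (simp add: v_def powr_minus_divide)
      finally have inv: "inverse (1 - exp (- v)) \<le> 1 + 1 / (2 * \<rho>) * t powr (- \<gamma>)" .
      have "Kfun \<alpha> \<rho> \<gamma> t = 2 * (exp (- ((\<alpha> + \<rho>) * t powr \<gamma>)) * inverse (1 - exp (- v)))"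
        unfolding v_def using assms(1) t by (rule Kfun_eq)
      then have "Kfun \<alpha> \<rho> \<gamma> t * t powr (\<sigma> - 1) \<le>
          2 * (exp (- ((\<alpha> + \<rho>) * t powr \<gamma>)) * (1 + 1 / (2 * \<rho>) * t powr (- \<gamma>))) * t powr (\<sigma> - 1)"
        using inv by (simp only:) (intro mult_right_mono mult_left_mono; simp)
      also have "\<dots> = ?B t"
      proof -
        have "t powr (\<sigma> - \<gamma> - 1) = t powr (- \<gamma>) * t powr (\<sigma> - 1)"
          by (simp add: algebra_simps flip: powr_add)
        then show ?thesis by (simp add: algebra_simps)
      qed
      finally have "Kfun \<alpha> \<rho> \<gamma> t * t powr (\<sigma> - 1) \<le> ?B t" .
      moreover have "0 \<le> Kfun \<alpha> \<rho> \<gamma> t * t powr (\<sigma> - 1)"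
        using Kfun_pos[OF assms(1) t] by (simp add: less_imp_le)
      ultimately show "norm (Kfun \<alpha> \<rho> \<gamma> t * t powr (\<sigma> - 1)) \<le> norm (?B t)"
        by simp
    qed
  qed (intro borel_measurable_lebesgue_on, measurable)
qed

section \<open>The discrete weight function\<close>

lemma nn_integral_lebesgue_on:
  fixes g :: "real \<Rightarrow> real"
  shows "(\<integral>\<^sup>+t. ennreal (g t) \<partial>lebesgue_on {0<..}) = (\<integral>\<^sup>+t. ennreal (g t) * indicator {0<..} t \<partial>lborel)"
  by (subst nn_integral_restrict_space) (auto simp: nn_integral_completion)

text \<open>Average the integral with its reflection at \<open>y\<close>.\<close>

lemma strict_midpoint_less_nn_integral:
  fixes \<phi> :: "real \<Rightarrow> real"
  assumes [measurable]: "\<phi> \<in> borel_measurable borel"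
    and nonneg: "\<And>t. 0 < t \<Longrightarrow> 0 \<le> \<phi> t"
    and mid: "\<And>x z. 0 < x \<Longrightarrow> x < z \<Longrightarrow> 2 * \<phi> ((x + z) / 2) < \<phi> x + \<phi> z"
    and ys: "0 < s" "s \<le> y"
  shows "ennreal (2 * s * \<phi> y) < (\<integral>\<^sup>+t. ennreal (\<phi> t) * indicator {y - s<..<y + s} t \<partial>lborel)"
proof -
  let ?J = "{y - s<..<y + s}"
  define I where "I = (\<integral>\<^sup>+t. ennreal (\<phi> t) * indicator ?J t \<partial>lborel)"
  have "I = (\<integral>\<^sup>+t. ennreal (\<phi> (2 * y + -1 * t)) * indicator ?J (2 * y + -1 * t) \<partial>lborel)"
    unfolding I_def by (subst nn_integral_real_affine[where c = "-1" and t = "2 * y"]) auto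
  also have "\<dots> = (\<integral>\<^sup>+t. ennreal (\<phi> (2 * y - t)) * indicator ?J t \<partial>lborel)"
    by (intro nn_integral_cong) (auto split: split_indicator)
  finally have "I + I = (\<integral>\<^sup>+t. ennreal (\<phi> t) * indicator ?J t + ennreal (\<phi> (2 * y - t)) * indicator ?J t \<partial>lborel)"
    by (subst nn_integral_add) (auto simp: I_def)
  also have "\<dots> = (\<integral>\<^sup>+t. ennreal (\<phi> t + \<phi> (2 * y - t)) * indicator ?J t \<partial>lborel)"
    using ys nonneg by (intro nn_integral_cong) (auto split: split_indicator)
  also have "\<dots> > (\<integral>\<^sup>+t. ennreal (2 * \<phi> y) * indicator ?J t \<partial>lborel)"
  proof (rule nn_integral_less)
    have less: "2 * \<phi> y < \<phi> t + \<phi> (2 * y - t)" if "t \<in> ?J" "t \<noteq> y" for t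
    proof (cases t y rule: linorder_cases)
      case less
      then show ?thesis using mid[of t "2 * y - t"] that ys by auto
    next
      case greater
      then show ?thesis using mid[of "2 * y - t" t] that ys by (auto simp: add.commute)
    qed (use that in auto)
    show "AE t in lborel. ennreal (2 * \<phi> y) * indicator ?J t \<le> ennreal (\<phi> t + \<phi> (2 * y - t)) * indicator ?J t"
    proof (rule AE_I2)
      fix t
      show "ennreal (2 * \<phi> y) * indicator ?J t \<le> ennreal (\<phi> t + \<phi> (2 * y - t)) * indicator ?J t"
        using less[of t] by (cases "t = y") (auto split: split_indicator intro!: ennreal_leI)
    qed
    \<comment> \<open>The inequality is strict on the interval except at its centre, so the reverse
      one almost everywhere would make the interval a null set.\<close>
    show "\<not> (AE t in lborel. ennreal (\<phi> t + \<phi> (2 * y - t)) * indicator ?J t \<le> ennreal (2 * \<phi> y) * indicator ?J t)"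
    proof
      assume "AE t in lborel. ennreal (\<phi> t + \<phi> (2 * y - t)) * indicator ?J t \<le> ennreal (2 * \<phi> y) * indicator ?J t"
      moreover have "AE t in lborel. t \<noteq> y" by (rule AE_lborel_singleton)
      ultimately have "AE t in lborel. t \<notin> ?J"
      proof eventually_elim
        case (elim t)
        show ?case
        proof
          assume t: "t \<in> ?J"
          then have "\<phi> t + \<phi> (2 * y - t) \<le> 2 * \<phi> y"
            using elim nonneg[of y] ys by (simp add: ennreal_le_iff)
          then show False using less[OF t] elim by simp
        qed
      qed
      then have "emeasure lborel ?J = 0"
        by (subst (asm) AE_iff_measurable[where N = ?J]) auto
      then show False using ys by simp
    qed
    show "(\<integral>\<^sup>+t. ennreal (2 * \<phi> y) * indicator ?J t \<partial>lborel) \<noteq> \<infinity>"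
      using ys by (simp add: nn_integral_cmult ennreal_mult_eq_top_iff)
  qed auto
  also have "(\<integral>\<^sup>+t. ennreal (2 * \<phi> y) * indicator ?J t \<partial>lborel) = ennreal (2 * s * \<phi> y) + ennreal (2 * s * \<phi> y)"
    using ys nonneg[of y] by (simp add: nn_integral_cmult flip: ennreal_mult ennreal_plus)
  \<comment> \<open>The doubled inequality is halved by contraposition, using monotonicity of
    addition.\<close>
  finally show ?thesis
    unfolding I_def[symmetric] by (meson add_mono leD leI)
qed

text \<open>The open intervals of radius \<open>s n\<close> about \<open>y n\<close> are disjoint
  and contained in the half-line, so the integrals over them add up to at most the whole. Termwise
  strictness survives summation because the smaller sum is finite; it is read off from integration
  over counting measure.\<close>

lemma suminf_less_nn_integral:
  fixes \<phi> :: "real \<Rightarrow> real"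
  assumes [measurable]: "\<phi> \<in> borel_measurable borel"
    and nonneg: "\<And>t. 0 < t \<Longrightarrow> 0 \<le> \<phi> t"
    and mid: "\<And>x z. 0 < x \<Longrightarrow> x < z \<Longrightarrow> 2 * \<phi> ((x + z) / 2) < \<phi> x + \<phi> z"
    and ys: "\<And>n. 0 < s n" "\<And>n. s n \<le> y n" "\<And>m n. m < n \<Longrightarrow> y m + s m \<le> y n - s n"
    and fin: "(\<integral>\<^sup>+t. ennreal (\<phi> t) \<partial>lebesgue_on {0<..}) < \<infinity>"
  shows "(\<Sum>n. ennreal (2 * s n * \<phi> (y n))) < (\<integral>\<^sup>+t. ennreal (\<phi> t) \<partial>lebesgue_on {0<..})"
proof -
  define J where "J n = {y n - s n<..<y n + s n}" for n
  have disj: "disjoint_family J"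
    unfolding disjoint_family_on_def
  proof (intro ballI impI)
    fix m n :: nat assume "m \<noteq> n"
    then show "J m \<inter> J n = {}"
      using ys(3)[of m n] ys(3)[of n m] by (cases m n rule: linorder_cases) (auto simp: J_def)
  qed
  define b where "b n = (\<integral>\<^sup>+t. ennreal (\<phi> t) * indicator (J n) t \<partial>lborel)" for n
  have lt: "ennreal (2 * s n * \<phi> (y n)) < b n" for n
    unfolding b_def J_def using ys by (intro strict_midpoint_less_nn_integral nonneg mid) auto
  have "(\<Sum>n. b n) = (\<integral>\<^sup>+t. (\<Sum>n. ennreal (\<phi> t) * indicator (J n) t) \<partial>lborel)"
    unfolding b_def by (intro nn_integral_suminf[symmetric]) (auto simp: J_def)
  also have "\<dots> = (\<integral>\<^sup>+t. ennreal (\<phi> t) * indicator (\<Union>n. J n) t \<partial>lborel)"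
    by (simp add: suminf_indicator[OF disj])
  also have "\<dots> \<le> (\<integral>\<^sup>+t. ennreal (\<phi> t) * indicator {0<..} t \<partial>lborel)"
  proof (rule nn_integral_mono)
    fix t
    have "J n \<subseteq> {0<..}" for n using ys(2)[of n] by (auto simp: J_def)
    then show "ennreal (\<phi> t) * indicator (\<Union>n. J n) t \<le> ennreal (\<phi> t) * indicator {0<..} t"
      by (auto split: split_indicator)
  qed
  finally have le: "(\<Sum>n. b n) \<le> (\<integral>\<^sup>+t. ennreal (\<phi> t) \<partial>lebesgue_on {0<..})"
    by (simp add: nn_integral_lebesgue_on)
  have "(\<Sum>n. ennreal (2 * s n * \<phi> (y n))) < (\<Sum>n. b n)"
    unfolding nn_integral_count_space_nat[symmetric]
  proof (rule nn_integral_less)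
    have "(\<Sum>n. ennreal (2 * s n * \<phi> (y n))) \<le> (\<Sum>n. b n)"
      using lt by (intro suminf_le) (auto intro: less_imp_le)
    then show "(\<integral>\<^sup>+n. ennreal (2 * s n * \<phi> (y n)) \<partial>count_space UNIV) \<noteq> \<infinity>"
      using le fin by (auto simp: nn_integral_count_space_nat top_unique)
  qed (use lt in \<open>auto simp: AE_count_space not_le intro: less_imp_le\<close>)
  then show ?thesis using le by simp
qed

lemma hardy_kernel_eq_Kfun:
  assumes "0 < W" "V \<nu> n - \<beta> = W"
  shows "hardy_kernel \<alpha> \<rho> \<gamma> \<beta> \<delta> \<mu> \<nu> x n = Kfun \<alpha> \<rho> \<gamma> (W * U \<mu> x powr \<delta>)"
  using assms by (simp add: hardy_kernel_def Kfun_def powr_mult powr_powr mult_ac)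

lemma kconst_eq: "kconst \<alpha> \<rho> \<gamma> \<sigma> = (LINT t|lebesgue_on {0<..}. Kfun \<alpha> \<rho> \<gamma> t * t powr (\<sigma> - 1))"
  by (simp add: kconst_def Kfun_def)

lemma nn_integral_Kfun_powr:
  assumes "0 < \<rho>" "0 < \<alpha> + \<rho>" "0 < \<gamma>" "\<gamma> < \<sigma>"
  shows "(\<integral>\<^sup>+t. ennreal (Kfun \<alpha> \<rho> \<gamma> t * t powr (\<sigma> - 1)) \<partial>lebesgue_on {0<..}) = ennreal (kconst \<alpha> \<rho> \<gamma> \<sigma>)"
  unfolding kconst_eq using assms
  by (intro nn_integral_eq_integral integrable_Kfun_powr AE_I2)
    (auto simp: space_restrict_space intro!: mult_nonneg_nonneg less_imp_le[OF Kfun_pos])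

locale decreasing_weights =
  fixes \<nu> :: "nat \<Rightarrow> real" and \<beta> :: real
  assumes \<nu>_pos: "\<And>n. 1 \<le> n \<Longrightarrow> 0 < \<nu> n"
    and \<nu>_decr: "\<And>n. 1 \<le> n \<Longrightarrow> \<nu> (Suc n) \<le> \<nu> n"
    and \<beta>_le: "\<beta> \<le> \<nu> 1 / 2"
begin

lemma V_Suc: "V \<nu> (Suc n) = V \<nu> n + \<nu> (Suc n)"
  by (simp add: V_def)

lemma V_mono: "m \<le> n \<Longrightarrow> V \<nu> m \<le> V \<nu> n"
  by (rule lift_Suc_mono_le[of "V \<nu>"]) (simp_all add: V_Suc less_imp_le \<nu>_pos)

lemma \<nu>_antimono: "1 \<le> m \<Longrightarrow> m \<le> n \<Longrightarrow> \<nu> n \<le> \<nu> m"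
  by (rotate_tac 1, induction n rule: dec_induct) (auto intro: order_trans[OF \<nu>_decr])

definition W :: "nat \<Rightarrow> real" where
  "W n = V \<nu> (Suc n) - \<beta>"

text \<open>This is where the bound on \<beta> enters. It gives positivity of \<open>W\<close> and
  leaves room to the left of the points \<open>W n\<close> for intervals of radius at most
  \<open>\<nu> 1 / 2\<close>.\<close>

lemma W_ge: "\<nu> 1 / 2 \<le> W n"
  using V_mono[of 1 "Suc n"] \<beta>_le by (simp add: W_def V_def)

lemma W_pos: "0 < W n"
  using W_ge[of n] \<nu>_pos[of 1] by simp

lemma W_Suc: "W (Suc n) = W n + \<nu> (Suc (Suc n))"
  by (simp add: W_def V_Suc)

lemma W_mono: "m \<le> n \<Longrightarrow> W m \<le> W n"
  using V_mono[of "Suc m" "Suc n"] by (simp add: W_def)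

text \<open>The intervals of radius \<open>\<nu> (n + 2) / 2\<close> around the points \<open>W n\<close> are disjoint because \<open>\<nu>\<close>
  decreases, and lie in the positive half-line because \<open>\<beta> \<le> \<nu> 1 / 2\<close>.\<close>

lemma discrete_weight_less:
  assumes "0 < \<rho>" "0 < \<alpha> + \<rho>" "0 < \<gamma>" "\<gamma> < \<sigma>" "\<sigma> \<le> 1" "0 < c"
  shows "(\<Sum>n. ennreal (c * \<nu> (Suc (Suc n)) * (Kfun \<alpha> \<rho> \<gamma> (c * W n) * (c * W n) powr (\<sigma> - 1))))
    < ennreal (kconst \<alpha> \<rho> \<gamma> \<sigma>)"
proof -
  define s where "s n = c * \<nu> (Suc (Suc n)) / 2" for n
  have "(\<Sum>n. ennreal (2 * s n * (Kfun \<alpha> \<rho> \<gamma> (c * W n) * (c * W n) powr (\<sigma> - 1))))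
    < (\<integral>\<^sup>+t. ennreal (Kfun \<alpha> \<rho> \<gamma> t * t powr (\<sigma> - 1)) \<partial>lebesgue_on {0<..})"
  proof (rule suminf_less_nn_integral)
    show "0 \<le> Kfun \<alpha> \<rho> \<gamma> t * t powr (\<sigma> - 1)" if "0 < t" for t
      using Kfun_pos[OF assms(1) that] by (simp add: less_imp_le)
    show "2 * (Kfun \<alpha> \<rho> \<gamma> ((x + z) / 2) * ((x + z) / 2) powr (\<sigma> - 1))
        < Kfun \<alpha> \<rho> \<gamma> x * x powr (\<sigma> - 1) + Kfun \<alpha> \<rho> \<gamma> z * z powr (\<sigma> - 1)"
      if "0 < x" "x < z" for x z
      using assms that by (intro Kfun_powr_strict_midconvex)
    show "0 < s n" for n using \<nu>_pos[of "Suc (Suc n)"] assms by (simp add: s_def)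
    show "s n \<le> c * W n" for n
    proof -
      have "\<nu> (Suc (Suc n)) / 2 \<le> W n"
        using \<nu>_antimono[of 1 "Suc (Suc n)"] W_ge[of n] by simp
      then have "c * (\<nu> (Suc (Suc n)) / 2) \<le> c * W n" using assms by (intro mult_left_mono) auto
      then show ?thesis by (simp add: s_def)
    qed
    show "c * W m + s m \<le> c * W n - s n" if "m < n" for m n
    proof -
      have "\<nu> (Suc (Suc n)) \<le> \<nu> (Suc (Suc m))" using that by (intro \<nu>_antimono) auto
      moreover have "W m + \<nu> (Suc (Suc m)) \<le> W n" using W_mono[of "Suc m" n] that by (simp add: W_Suc)
      ultimately have "W m + \<nu> (Suc (Suc m)) / 2 + \<nu> (Suc (Suc n)) / 2 \<le> W n" by simp
      then have "c * (W m + \<nu> (Suc (Suc m)) / 2 + \<nu> (Suc (Suc n)) / 2) \<le> c * W n"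
        using assms by (intro mult_left_mono) auto
      then show ?thesis by (simp add: s_def algebra_simps)
    qed
  qed (use assms in \<open>auto simp: nn_integral_Kfun_powr\<close>)
  then show ?thesis
    using assms by (simp add: nn_integral_Kfun_powr s_def)
qed

end

section \<open>The weighted inequalities\<close>

text \<open>The weight is split off as \<open>w powr (1 / p)\<close> on one factor and its inverse
  on the other; since - q/p = 1 - q, the dual weight is \<open>w powr (1 - q)\<close>.\<close>

lemma weighted_Holder:
  assumes [measurable]: "w \<in> borel_measurable M" "b \<in> borel_measurable M" "G \<in> borel_measurable M"
    and pos: "\<And>x. x \<in> space M \<Longrightarrow> 0 < w x \<and> 0 \<le> b x"
    and pq: "1 < p" "1 < q" "1 / p + 1 / q = 1"
  shows "(\<integral>\<^sup>+x. G x * ennreal (b x) \<partial>M) \<le>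
    epowr (\<integral>\<^sup>+x. ennreal (w x) * epowr (G x) p \<partial>M) (1 / p)
      * epowr (\<integral>\<^sup>+x. ennreal (w x powr (1 - q) * b x powr q) \<partial>M) (1 / q)"
proof -
  let ?f = "\<lambda>x. ennreal (w x powr (1 / p)) * G x"
  let ?g = "\<lambda>x. ennreal (w x powr (- (1 / p)) * b x)"
  have exponent: "- (1 / p) * q = 1 - q"
  proof -
    have "1 / p = 1 - 1 / q" using pq by simp
    then have "1 / p * q = (1 - 1 / q) * q" by simp
    also have "\<dots> = q - 1" using pq by (simp add: left_diff_distrib)
    finally show ?thesis by simp
  qed
  have "(\<integral>\<^sup>+x. G x * ennreal (b x) \<partial>M) = (\<integral>\<^sup>+x. ?f x * ?g x \<partial>M)"
  proof (rule nn_integral_cong)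
    fix x assume x: "x \<in> space M"
    have "ennreal (w x powr (1 / p)) * ?g x = ennreal (w x powr (1 / p) * (w x powr (- (1 / p)) * b x))"
      using pos[OF x] by (simp add: ennreal_mult)
    also have "w x powr (1 / p) * (w x powr (- (1 / p)) * b x) = b x"
      using pos[OF x] by (simp add: powr_minus)
    finally show "G x * ennreal (b x) = ?f x * ?g x"
      by (metis mult.assoc mult.commute)
  qed
  also have "\<dots> \<le> epowr (\<integral>\<^sup>+x. epowr (?f x) p \<partial>M) (1 / p) * epowr (\<integral>\<^sup>+x. epowr (?g x) q \<partial>M) (1 / q)"
    by (intro nn_integral_Holder pq) auto
  also have "(\<integral>\<^sup>+x. epowr (?f x) p \<partial>M) = (\<integral>\<^sup>+x. ennreal (w x) * epowr (G x) p \<partial>M)"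
    using pos pq by (intro nn_integral_cong) (simp add: epowr_mult powr_powr less_imp_le)
  also have "(\<integral>\<^sup>+x. epowr (?g x) q \<partial>M) = (\<integral>\<^sup>+x. ennreal (w x powr (1 - q) * b x powr q) \<partial>M)"
  proof (rule nn_integral_cong)
    fix x assume x: "x \<in> space M"
    have "(w x powr (- (1 / p)) * b x) powr q = w x powr (- (1 / p) * q) * b x powr q"
      using pos[OF x] by (simp add: powr_mult powr_powr)
    then show "epowr (?g x) q = ennreal (w x powr (1 - q) * b x powr q)"
      unfolding exponent using pos[OF x] by simp
  qed
  finally show ?thesis .
qed

locale hardy_setting = decreasing_weights \<nu> \<beta> for \<nu> \<beta> +
  fixes \<mu> :: "real \<Rightarrow> real" and \<alpha> \<rho> \<gamma> \<sigma> \<delta> p q :: real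
  assumes \<mu>_cont: "continuous_on {0<..} \<mu>"
    and \<mu>_pos: "\<forall>x>0. 0 < \<mu> x"
    and \<mu>_int: "\<forall>x>0. integrable (lebesgue_on {0<..x}) \<mu>"
    and \<delta>: "\<delta> \<in> {-1, 1}"
    and \<rho>: "0 < \<rho>" "0 < \<alpha> + \<rho>"
    and \<gamma>\<sigma>: "0 < \<gamma>" "\<gamma> < \<sigma>" "\<sigma> \<le> 1"
    and pq: "1 < p" "1 < q" "1 / p + 1 / q = 1"
    and U_lim: "filterlim (U \<mu>) at_top at_top"
begin

abbreviation "L \<equiv> lebesgue_on {0::real<..}"

abbreviation "k \<equiv> kconst \<alpha> \<rho> \<gamma> \<sigma>"

text \<open>Under \<open>s = U \<mu> x powr \<delta>\<close> the measure \<open>m x dx\<close> becomes \<open>s powr (\<sigma> - 1) ds\<close>; \<open>N\<close> is its discrete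
  counterpart. The index of \<open>K\<close>, \<open>N\<close> and \<open>W\<close> starts at \<open>0\<close>, so \<open>K n\<close> is the kernel at \<open>Suc n\<close>.\<close>

definition K :: "nat \<Rightarrow> real \<Rightarrow> real" where
  "K n x = Kfun \<alpha> \<rho> \<gamma> (W n * U \<mu> x powr \<delta>)"

definition N :: "nat \<Rightarrow> real" where
  "N n = \<nu> (Suc (Suc n)) * W n powr (\<sigma> - 1)"

definition m :: "real \<Rightarrow> real" where
  "m x = \<mu> x * U \<mu> x powr (\<delta> * \<sigma> - 1)"

lemma U_pos: "0 < x \<Longrightarrow> 0 < U \<mu> x"
  using U_gt_0[OF \<mu>_cont \<mu>_pos \<mu>_int] .

lemma K_pos: "0 < x \<Longrightarrow> 0 < K n x"
  unfolding K_def using W_pos[of n] U_pos[of x] by (intro Kfun_pos \<rho>) auto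

lemma N_pos: "0 < N n"
  unfolding N_def using \<nu>_pos[of "Suc (Suc n)"] W_pos[of n] by simp

lemma m_pos: "0 < x \<Longrightarrow> 0 < m x"
  using \<mu>_pos U_pos[of x] by (simp add: m_def)

lemma pq_mult: "(p - 1) * (q - 1) = 1"
  using pq by (simp add: field_simps)

lemma borel_measurable_U [measurable]: "U \<mu> \<in> borel_measurable L"
  using continuous_on_U[OF \<mu>_cont \<mu>_pos \<mu>_int]
  by (intro continuous_imp_measurable_on_sets_lebesgue) auto

lemma borel_measurable_\<mu> [measurable]: "\<mu> \<in> borel_measurable L"
  using \<mu>_cont by (intro continuous_imp_measurable_on_sets_lebesgue) auto

lemma borel_measurable_m [measurable]: "m \<in> borel_measurable L"
  unfolding m_def[abs_def] by measurable

lemma borel_measurable_K [measurable]: "K n \<in> borel_measurable L"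
  unfolding K_def[abs_def] by measurable

lemma hardy_kernel_eq: "hardy_kernel \<alpha> \<rho> \<gamma> \<beta> \<delta> \<mu> \<nu> x (Suc n) = K n x"
  unfolding K_def by (intro hardy_kernel_eq_Kfun W_pos) (simp add: W_def)

text \<open>Writing \<open>f = m * v\<close>, the integrand of the norm becomes
  \<open>m * U powr (- \<delta>\<sigma>) * v powr p\<close>, which is \<open>v powr p ds / s\<close>
  in the variable \<open>s = U powr \<delta>\<close>. Constant \<open>v\<close> is thus the formal
  extremal.\<close>

lemma \<Phi>_eq: "0 < x \<Longrightarrow> \<Phi> p \<sigma> \<delta> \<mu> x = m x powr (1 - p) * U \<mu> x powr (- (\<delta> * \<sigma>))"
proof -
  assume x: "0 < x"
  have "m x powr (1 - p) = \<mu> x powr (1 - p) * U \<mu> x powr ((\<delta> * \<sigma> - 1) * (1 - p))"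
    using \<mu>_pos U_pos[OF x] x by (simp add: m_def powr_mult powr_powr less_imp_le)
  moreover have "(\<delta> * \<sigma> - 1) * (1 - p) + - (\<delta> * \<sigma>) = p * (1 - \<delta> * \<sigma>) - 1"
    by (simp add: algebra_simps)
  moreover have "\<mu> x powr (1 - p) = 1 / \<mu> x powr (p - 1)"
    by (simp flip: powr_minus_divide)
  ultimately show ?thesis
    by (simp add: \<Phi>_def mult.assoc flip: powr_add)
qed

lemma \<Psi>_eq: "\<Psi> q \<sigma> \<beta> \<nu> (Suc n) = N n powr (1 - q) * W n powr (- \<sigma>)"
proof -
  have "N n powr (1 - q) = \<nu> (Suc (Suc n)) powr (1 - q) * W n powr ((\<sigma> - 1) * (1 - q))"
    using \<nu>_pos[of "Suc (Suc n)"] W_pos[of n] by (simp add: N_def powr_mult powr_powr less_imp_le)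
  moreover have "(\<sigma> - 1) * (1 - q) + - \<sigma> = q * (1 - \<sigma>) - 1"
    by (simp add: algebra_simps)
  moreover have "\<nu> (Suc (Suc n)) powr (1 - q) = 1 / \<nu> (Suc (Suc n)) powr (q - 1)"
    by (simp flip: powr_minus_divide)
  ultimately show ?thesis
    by (simp add: \<Psi>_def W_def mult.assoc flip: powr_add)
qed

text \<open>The exponent \<open>(p - 1) * \<sigma>\<close> cancels the power \<open>p - 1\<close> of
  \<open>W n powr (- \<sigma>)\<close>, the factor that Hoelder's inequality takes from the integral
  weight.\<close>

lemma seq_weight_eq: "\<nu> (Suc (Suc n)) / (V \<nu> (Suc n) - \<beta>) powr (1 - p * \<sigma>) = N n * W n powr ((p - 1) * \<sigma>)"
proof -
  have "1 / W n powr (1 - p * \<sigma>) = W n powr (\<sigma> - 1) * W n powr ((p - 1) * \<sigma>)"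
    by (simp add: algebra_simps flip: powr_minus_divide powr_add)
  then show ?thesis by (simp add: N_def W_def divide_inverse)
qed

lemma fun_weight_eq: "\<mu> x / U \<mu> x powr (1 - q * \<delta> * \<sigma>) = m x * U \<mu> x powr ((q - 1) * (\<delta> * \<sigma>))"
proof -
  have "1 / U \<mu> x powr (1 - q * \<delta> * \<sigma>) = U \<mu> x powr (\<delta> * \<sigma> - 1) * U \<mu> x powr ((q - 1) * (\<delta> * \<sigma>))"
    by (simp add: algebra_simps flip: powr_minus_divide powr_add)
  then show ?thesis by (simp add: m_def divide_inverse)
qed

text \<open>Substituting \<open>t = c * U powr \<delta>\<close> and splitting off
  \<open>t powr (\<sigma> - 1)\<close> leaves the factor \<open>c powr (- \<sigma>)\<close>. A
  general \<open>g\<close> covers the kernel, its truncation, and the cut-off in the norm of the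
  test function.\<close>

lemma nn_integral_m:
  assumes [measurable]: "g \<in> borel_measurable borel"
    and c: "0 < c" and g: "\<And>t. 0 < t \<Longrightarrow> 0 \<le> g t"
    and int: "integrable L (\<lambda>t. g t * t powr (\<sigma> - 1))"
  shows "(\<integral>\<^sup>+x. ennreal (g (c * U \<mu> x powr \<delta>) * m x) \<partial>L)
    = ennreal (c powr (- \<sigma>)) * (\<integral>\<^sup>+t. ennreal (g t * t powr (\<sigma> - 1)) \<partial>L)"
proof -
  have "(\<integral>\<^sup>+x. ennreal (g (c * U \<mu> x powr \<delta>) * m x) \<partial>L)
      = (\<integral>\<^sup>+x. ennreal (c powr (- \<sigma>)) * ennreal (c * U \<mu> x powr (\<delta> - 1) * \<mu> x
          * (g (c * U \<mu> x powr \<delta>) * (c * U \<mu> x powr \<delta>) powr (\<sigma> - 1))) \<partial>L)"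
  proof (rule nn_integral_cong)
    fix x assume "x \<in> space L"
    then have x: "0 < x" by (simp add: space_restrict_space)
    let ?u = "U \<mu> x"
    have u: "0 < ?u" using U_pos[OF x] .
    have "?u powr (\<delta> - 1) * (?u powr \<delta>) powr (\<sigma> - 1) = ?u powr (\<delta> * \<sigma> - 1)"
      by (simp add: powr_powr algebra_simps flip: powr_add)
    moreover have "c powr (- \<sigma>) * (c * c powr (\<sigma> - 1)) = 1"
      using c by (simp add: powr_diff powr_minus)
    moreover have "(c * ?u powr \<delta>) powr (\<sigma> - 1) = c powr (\<sigma> - 1) * (?u powr \<delta>) powr (\<sigma> - 1)"
      using c by (simp add: powr_mult)
    moreover have "c powr (- \<sigma>) * (c * ?u powr (\<delta> - 1) * \<mu> x * (g (c * ?u powr \<delta>) * (c powr (\<sigma> - 1) * (?u powr \<delta>) powr (\<sigma> - 1))))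
        = (c powr (- \<sigma>) * (c * c powr (\<sigma> - 1))) * (g (c * ?u powr \<delta>) * (\<mu> x * (?u powr (\<delta> - 1) * (?u powr \<delta>) powr (\<sigma> - 1))))"
      by (simp only: mult_ac)
    ultimately have eq: "g (c * ?u powr \<delta>) * m x = c powr (- \<sigma>) * (c * ?u powr (\<delta> - 1) * \<mu> x
          * (g (c * ?u powr \<delta>) * (c * ?u powr \<delta>) powr (\<sigma> - 1)))"
      unfolding m_def by (simp only: mult_1_left)
    show "ennreal (g (c * ?u powr \<delta>) * m x) = ennreal (c powr (- \<sigma>)) * ennreal (c * ?u powr (\<delta> - 1) * \<mu> x
          * (g (c * ?u powr \<delta>) * (c * ?u powr \<delta>) powr (\<sigma> - 1)))"
      unfolding eq by (rule ennreal_mult') simp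
  qed
  also have "\<dots> = ennreal (c powr (- \<sigma>)) * (\<integral>\<^sup>+x. ennreal (c * U \<mu> x powr (\<delta> - 1) * \<mu> x
          * (g (c * U \<mu> x powr \<delta>) * (c * U \<mu> x powr \<delta>) powr (\<sigma> - 1))) \<partial>L)"
    by (rule nn_integral_cmult) measurable
  also have "(\<integral>\<^sup>+x. ennreal (c * U \<mu> x powr (\<delta> - 1) * \<mu> x
          * (g (c * U \<mu> x powr \<delta>) * (c * U \<mu> x powr \<delta>) powr (\<sigma> - 1))) \<partial>L)
      = (\<integral>\<^sup>+t. ennreal (g t * t powr (\<sigma> - 1)) \<partial>L)"
    by (rule nn_integral_substitution_U[OF \<mu>_cont \<mu>_pos \<mu>_int U_lim \<delta> c int]) (simp add: g)
  finally show ?thesis .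
qed

text \<open>Read off from the strict bound on the discrete weight at scale 1.\<close>

lemma k_pos: "0 < k"
proof -
  have "0 \<le> (\<Sum>n. ennreal (1 * \<nu> (Suc (Suc n)) * (Kfun \<alpha> \<rho> \<gamma> (1 * W n) * (1 * W n) powr (\<sigma> - 1))))"
    by simp
  also have "\<dots> < ennreal k"
    by (intro discrete_weight_less \<rho> \<gamma>\<sigma>) simp
  finally show ?thesis by simp
qed

lemma fun_weight_integral:
  "(\<integral>\<^sup>+x. ennreal (K n x * m x) \<partial>L) = ennreal (k * W n powr (- \<sigma>))"
proof -
  have "(\<integral>\<^sup>+x. ennreal (K n x * m x) \<partial>L)
      = ennreal (W n powr (- \<sigma>)) * (\<integral>\<^sup>+t. ennreal (Kfun \<alpha> \<rho> \<gamma> t * t powr (\<sigma> - 1)) \<partial>L)"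
    unfolding K_def using \<rho> \<gamma>\<sigma>
    by (intro nn_integral_m W_pos integrable_Kfun_powr) (auto intro: less_imp_le Kfun_pos)
  then show ?thesis
    using \<rho> \<gamma>\<sigma> k_pos by (simp add: nn_integral_Kfun_powr ennreal_mult mult.commute)
qed

text \<open>The discrete weight at scale \<open>c = U \<mu> x powr \<delta>\<close>; the powers of
  \<open>c\<close> collect to \<open>c powr (- \<sigma>)\<close>.\<close>

lemma seq_weight_sum_less:
  assumes x: "0 < x"
  shows "(\<Sum>n. ennreal (K n x * N n)) < ennreal (k * U \<mu> x powr (- (\<delta> * \<sigma>)))"
proof -
  define c where "c = U \<mu> x powr \<delta>"
  have c: "0 < c" using U_pos[OF x] by (simp add: c_def)
  have c\<sigma>: "c powr (- \<sigma>) = U \<mu> x powr (- (\<delta> * \<sigma>))"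
    by (simp add: c_def powr_powr)
  have eq: "K n x * N n = c powr (- \<sigma>) * (c * \<nu> (Suc (Suc n)) * (Kfun \<alpha> \<rho> \<gamma> (c * W n) * (c * W n) powr (\<sigma> - 1)))" for n
  proof -
    have "c powr (- \<sigma>) * (c * c powr (\<sigma> - 1)) = 1"
      using c by (simp add: powr_diff powr_minus)
    moreover have "c powr (- \<sigma>) * (c * \<nu> (Suc (Suc n)) * (Kfun \<alpha> \<rho> \<gamma> (c * W n) * (c powr (\<sigma> - 1) * W n powr (\<sigma> - 1))))
        = (c powr (- \<sigma>) * (c * c powr (\<sigma> - 1))) * (Kfun \<alpha> \<rho> \<gamma> (c * W n) * (\<nu> (Suc (Suc n)) * W n powr (\<sigma> - 1)))"
      by (simp only: mult_ac)
    moreover have "(c * W n) powr (\<sigma> - 1) = c powr (\<sigma> - 1) * W n powr (\<sigma> - 1)"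
      using c W_pos[of n] by (simp add: powr_mult)
    ultimately show ?thesis
      unfolding K_def N_def c_def[symmetric] mult.commute[of "W n" c] by (simp only: mult_1_left)
  qed
  have "(\<Sum>n. ennreal (K n x * N n))
    = ennreal (c powr (- \<sigma>)) * (\<Sum>n. ennreal (c * \<nu> (Suc (Suc n)) * (Kfun \<alpha> \<rho> \<gamma> (c * W n) * (c * W n) powr (\<sigma> - 1))))"
    unfolding eq by (simp add: ennreal_mult' ennreal_suminf_cmult)
  also have "\<dots> < ennreal (c powr (- \<sigma>)) * ennreal k"
    using c by (intro ennreal_mult_strict_left_mono discrete_weight_less \<rho> \<gamma>\<sigma>) auto
  finally show ?thesis
    using k_pos by (simp add: c\<sigma> ennreal_mult mult.commute)
qed

end

section \<open>The bilinear form and the two transforms\<close>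

context hardy_setting begin

abbreviation "fnorm \<equiv> fun_norm p (\<Phi> p \<sigma> \<delta> \<mu>)"
abbreviation "snorm \<equiv> seq_norm q (\<Psi> q \<sigma> \<beta> \<nu>)"
abbreviation "adm_fun \<equiv> admissible_fun p (\<Phi> p \<sigma> \<delta> \<mu>)"
abbreviation "adm_seq \<equiv> admissible_seq q (\<Psi> q \<sigma> \<beta> \<nu>)"

text \<open>With the two transforms below, these are the left sides of the three inequalities,
  kernel and weights being rewritten in \<open>K\<close>, \<open>N\<close>, \<open>W\<close> and
  \<open>m\<close>.\<close>

definition bilinear :: "(real \<Rightarrow> real) \<Rightarrow> (nat \<Rightarrow> real) \<Rightarrow> ennreal" where
  "bilinear f a = (\<Sum>n. \<integral>\<^sup>+x. ennreal (K n x * a (Suc n) * f x) \<partial>L)"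

definition seq_transform :: "(real \<Rightarrow> real) \<Rightarrow> ennreal" where
  "seq_transform f = epowr (\<Sum>n. ennreal (N n * W n powr ((p - 1) * \<sigma>)) *
     epowr (\<integral>\<^sup>+x. ennreal (K n x * f x) \<partial>L) p) (1 / p)"

definition fun_transform :: "(nat \<Rightarrow> real) \<Rightarrow> ennreal" where
  "fun_transform a = epowr (\<integral>\<^sup>+x. ennreal (m x * U \<mu> x powr ((q - 1) * (\<delta> * \<sigma>))) *
     epowr (\<Sum>n. ennreal (K n x * a (Suc n))) q \<partial>L) (1 / q)"

lemma space_L: "x \<in> space L \<longleftrightarrow> 0 < x"
  by (simp add: space_restrict_space)

lemma seq_weight_pos: "0 < N n * W n powr s"
  using N_pos[of n] W_pos[of n] by simp

lemma fun_weight_pos: "0 < x \<Longrightarrow> 0 < m x * U \<mu> x powr s"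
  using m_pos[of x] U_pos[of x] by simp

text \<open>Hoelder in \<open>n\<close> with the weight of \<open>seq_transform\<close>. The dual
  weight is its power \<open>1 - q\<close>, which \<open>(p - 1) * (q - 1) = 1\<close> turns into
  \<Psi>.\<close>

lemma bilinear_le_seq_transform:
  assumes [measurable]: "f \<in> borel_measurable L" and f: "\<And>x. 0 < x \<Longrightarrow> 0 \<le> f x" and a: "\<And>n. 1 \<le> n \<Longrightarrow> 0 \<le> a n"
  shows "bilinear f a \<le> seq_transform f * snorm a"
proof -
  let ?G = "\<lambda>n. \<integral>\<^sup>+x. ennreal (K n x * f x) \<partial>L"
  let ?w = "\<lambda>n. N n * W n powr ((p - 1) * \<sigma>)"
  have "bilinear f a = (\<Sum>n. ?G n * ennreal (a (Suc n)))"
    unfolding bilinear_def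
  proof (rule suminf_cong)
    fix n
    have "(\<integral>\<^sup>+x. ennreal (K n x * a (Suc n) * f x) \<partial>L) = (\<integral>\<^sup>+x. ennreal (K n x * f x) * ennreal (a (Suc n)) \<partial>L)"
      using a f K_pos
      by (intro nn_integral_cong) (simp add: space_L mult_ac less_imp_le flip: ennreal_mult)
    also have "\<dots> = ?G n * ennreal (a (Suc n))"
      by (rule nn_integral_multc) measurable
    finally show "(\<integral>\<^sup>+x. ennreal (K n x * a (Suc n) * f x) \<partial>L) = ?G n * ennreal (a (Suc n))" .
  qed
  also have "\<dots> \<le> epowr (\<Sum>n. ennreal (?w n) * epowr (?G n) p) (1 / p)
      * epowr (\<Sum>n. ennreal (?w n powr (1 - q) * a (Suc n) powr q)) (1 / q)"
    unfolding nn_integral_count_space_nat[symmetric]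
    using a seq_weight_pos pq by (intro weighted_Holder) auto
  also have "(\<lambda>n. ?w n powr (1 - q) * a (Suc n) powr q) = (\<lambda>n. \<Psi> q \<sigma> \<beta> \<nu> (Suc n) * a (Suc n) powr q)"
  proof
    fix n
    have "(p - 1) * \<sigma> * (1 - q) = - ((p - 1) * (q - 1) * \<sigma>)" by (simp add: algebra_simps)
    then have "(p - 1) * \<sigma> * (1 - q) = - \<sigma>" by (simp add: pq_mult)
    then show "?w n powr (1 - q) * a (Suc n) powr q = \<Psi> q \<sigma> \<beta> \<nu> (Suc n) * a (Suc n) powr q"
      using N_pos[of n] by (simp add: \<Psi>_eq powr_mult powr_powr less_imp_le)
  qed
  finally show ?thesis
    by (simp add: seq_transform_def seq_norm_def)
qed

text \<open>After Tonelli this is Hoelder in \<open>x\<close> with \<open>p\<close> and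
  \<open>q\<close> exchanged; the power \<open>1 - p\<close> of the weight of
  \<open>fun_transform\<close> is \<Phi>.\<close>

lemma bilinear_le_fun_transform:
  assumes [measurable]: "f \<in> borel_measurable L" and f: "\<And>x. 0 < x \<Longrightarrow> 0 \<le> f x" and a: "\<And>n. 1 \<le> n \<Longrightarrow> 0 \<le> a n"
  shows "bilinear f a \<le> fun_transform a * fnorm f"
proof -
  let ?H = "\<lambda>x. \<Sum>n. ennreal (K n x * a (Suc n))"
  let ?w = "\<lambda>x. m x * U \<mu> x powr ((q - 1) * (\<delta> * \<sigma>))"
  have "bilinear f a = (\<integral>\<^sup>+x. (\<Sum>n. ennreal (K n x * a (Suc n) * f x)) \<partial>L)"
    unfolding bilinear_def by (rule nn_integral_suminf[symmetric]) measurable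
  also have "\<dots> = (\<integral>\<^sup>+x. ?H x * ennreal (f x) \<partial>L)"
    using f by (intro nn_integral_cong) (simp add: space_L ennreal_mult'' ennreal_suminf_multc)
  also have "\<dots> \<le> epowr (\<integral>\<^sup>+x. ennreal (?w x) * epowr (?H x) q \<partial>L) (1 / q)
      * epowr (\<integral>\<^sup>+x. ennreal (?w x powr (1 - p) * f x powr p) \<partial>L) (1 / p)"
    using f fun_weight_pos pq by (intro weighted_Holder) (auto simp: space_L add.commute)
  also have "(\<integral>\<^sup>+x. ennreal (?w x powr (1 - p) * f x powr p) \<partial>L) = (\<integral>\<^sup>+x. ennreal (\<Phi> p \<sigma> \<delta> \<mu> x * f x powr p) \<partial>L)"
  proof (rule nn_integral_cong)
    fix x assume "x \<in> space L"
    then have x: "0 < x" by (simp add: space_L)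
    have "(q - 1) * (\<delta> * \<sigma>) * (1 - p) = - ((p - 1) * (q - 1) * (\<delta> * \<sigma>))" by (simp add: algebra_simps)
    then have "(q - 1) * (\<delta> * \<sigma>) * (1 - p) = - (\<delta> * \<sigma>)" by (simp add: pq_mult)
    then show "ennreal (?w x powr (1 - p) * f x powr p) = ennreal (\<Phi> p \<sigma> \<delta> \<mu> x * f x powr p)"
      using m_pos[OF x] by (simp add: \<Phi>_eq[OF x] powr_mult powr_powr less_imp_le)
  qed
  finally show ?thesis
    by (simp add: fun_transform_def fun_norm_def)
qed

text \<open>Hoelder against the measure \<open>K n x * m x dx\<close>, whose mass is known exactly,
  cancels the power of \<open>W n\<close>. Summation and Tonelli then bring the discrete weight
  under the integral, where it is strictly smaller at every \<open>x\<close>.\<close>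

lemma seq_transform_less:
  assumes adm: "adm_fun f"
  shows "seq_transform f < ennreal k * fnorm f"
proof -
  have [measurable]: "f \<in> borel_measurable L" and f: "\<And>x. 0 < x \<Longrightarrow> 0 \<le> f x"
    using adm by (auto simp: admissible_fun_def)
  define X where "X = (\<integral>\<^sup>+x. ennreal (\<Phi> p \<sigma> \<delta> \<mu> x * f x powr p) \<partial>L)"
  have fnorm: "fnorm f = epowr X (1 / p)" by (simp add: fun_norm_def X_def)
  have X: "X \<noteq> 0" "X \<noteq> top"
    using adm unfolding admissible_fun_def fnorm by auto
  \<comment> \<open>The p-th power of the normalised function \<open>f / m\<close> with density
    \<open>m\<close>; multiplied by \<open>U powr (- \<delta>\<sigma>)\<close> it is the integrand
    of the norm.\<close>
  define e where "e x = m x * (f x / m x) powr p" for x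
  have [measurable]: "e \<in> borel_measurable L" unfolding e_def[abs_def] by measurable
  have e_nonneg: "0 \<le> e x" if "0 < x" for x using m_pos[OF that] by (simp add: e_def)
  have e_\<Phi>: "U \<mu> x powr (- (\<delta> * \<sigma>)) * e x = \<Phi> p \<sigma> \<delta> \<mu> x * f x powr p" if x: "0 < x" for x
  proof -
    have "e x = m x powr (1 - p) * f x powr p"
      using m_pos[OF x] f[OF x] by (simp add: e_def powr_divide powr_diff)
    then show ?thesis by (simp add: \<Phi>_eq[OF x])
  qed
  define R where "R = (\<integral>\<^sup>+x. (\<Sum>n. ennreal (K n x * N n)) * ennreal (e x) \<partial>L)"
  have summand: "ennreal (N n * W n powr ((p - 1) * \<sigma>)) * epowr (\<integral>\<^sup>+x. ennreal (K n x * f x) \<partial>L) p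
      \<le> ennreal (k powr (p - 1)) * (\<integral>\<^sup>+x. ennreal (K n x * N n) * ennreal (e x) \<partial>L)" for n
  proof -
    have "(\<integral>\<^sup>+x. ennreal (K n x * f x) \<partial>L) = (\<integral>\<^sup>+x. ennreal (K n x * m x) * ennreal (f x / m x) \<partial>L)"
    proof (rule nn_integral_cong)
      fix x assume "x \<in> space L"
      then have x: "0 < x" by (simp add: space_L)
      show "ennreal (K n x * f x) = ennreal (K n x * m x) * ennreal (f x / m x)"
        using m_pos[OF x] K_pos[OF x, of n] f[OF x] by (simp flip: ennreal_mult)
    qed
    then have "epowr (\<integral>\<^sup>+x. ennreal (K n x * f x) \<partial>L) p
        \<le> epowr (\<integral>\<^sup>+x. ennreal (K n x * m x) \<partial>L) (p - 1)
          * (\<integral>\<^sup>+x. ennreal (K n x * m x) * epowr (ennreal (f x / m x)) p \<partial>L)"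
      using pq by (simp only:) (intro epowr_nn_integral_weighted_le; measurable)
    also have "(\<integral>\<^sup>+x. ennreal (K n x * m x) * epowr (ennreal (f x / m x)) p \<partial>L)
        = (\<integral>\<^sup>+x. ennreal (K n x) * ennreal (e x) \<partial>L)"
    proof (rule nn_integral_cong)
      fix x assume "x \<in> space L"
      then have x: "0 < x" by (simp add: space_L)
      show "ennreal (K n x * m x) * epowr (ennreal (f x / m x)) p = ennreal (K n x) * ennreal (e x)"
        using m_pos[OF x] K_pos[OF x, of n] f[OF x] by (simp add: e_def mult_ac flip: ennreal_mult)
    qed
    also have "epowr (\<integral>\<^sup>+x. ennreal (K n x * m x) \<partial>L) (p - 1)
        = ennreal (k powr (p - 1) * W n powr (- ((p - 1) * \<sigma>)))"
      unfolding fun_weight_integral using k_pos by (simp add: powr_mult powr_powr mult.commute)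
    finally have "ennreal (N n * W n powr ((p - 1) * \<sigma>)) * epowr (\<integral>\<^sup>+x. ennreal (K n x * f x) \<partial>L) p
      \<le> ennreal (N n * W n powr ((p - 1) * \<sigma>)) *
        (ennreal (k powr (p - 1) * W n powr (- ((p - 1) * \<sigma>))) * (\<integral>\<^sup>+x. ennreal (K n x) * ennreal (e x) \<partial>L))"
      by (rule mult_left_mono) simp
    also have "\<dots> = ennreal (k powr (p - 1) * N n) * (\<integral>\<^sup>+x. ennreal (K n x) * ennreal (e x) \<partial>L)"
    proof -
      have "N n * W n powr ((p - 1) * \<sigma>) * (k powr (p - 1) * W n powr (- ((p - 1) * \<sigma>))) = k powr (p - 1) * N n"
        using W_pos[of n] by (simp add: powr_minus)
      then have "ennreal (N n * W n powr ((p - 1) * \<sigma>)) * ennreal (k powr (p - 1) * W n powr (- ((p - 1) * \<sigma>)))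
          = ennreal (k powr (p - 1) * N n)"
        using N_pos[of n] by (subst ennreal_mult[symmetric]) auto
      then show ?thesis by (simp only: mult.assoc[symmetric])
    qed
    also have "\<dots> = ennreal (k powr (p - 1)) * (\<integral>\<^sup>+x. ennreal (N n) * (ennreal (K n x) * ennreal (e x)) \<partial>L)"
      using N_pos[of n] by (subst nn_integral_cmult) (simp_all add: ennreal_mult mult.assoc)
    also have "(\<integral>\<^sup>+x. ennreal (N n) * (ennreal (K n x) * ennreal (e x)) \<partial>L) = (\<integral>\<^sup>+x. ennreal (K n x * N n) * ennreal (e x) \<partial>L)"
      using N_pos[of n] K_pos[of _ n]
      by (intro nn_integral_cong) (simp add: space_L ennreal_mult less_imp_le mult_ac)
    finally show ?thesis .
  qed
  have "(\<Sum>n. ennreal (N n * W n powr ((p - 1) * \<sigma>)) * epowr (\<integral>\<^sup>+x. ennreal (K n x * f x) \<partial>L) p)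
      \<le> (\<Sum>n. ennreal (k powr (p - 1)) * (\<integral>\<^sup>+x. ennreal (K n x * N n) * ennreal (e x) \<partial>L))"
    by (intro suminf_le summand) auto
  also have "\<dots> = ennreal (k powr (p - 1)) * R"
    unfolding R_def by (simp add: nn_integral_suminf ennreal_suminf_cmult flip: ennreal_suminf_multc)
  also have "\<dots> < ennreal (k powr (p - 1)) * (ennreal k * X)"
  proof (rule ennreal_mult_strict_left_mono)
    have kX: "ennreal k * X = (\<integral>\<^sup>+x. ennreal (k * U \<mu> x powr (- (\<delta> * \<sigma>))) * ennreal (e x) \<partial>L)"
    proof -
      have "X = (\<integral>\<^sup>+x. ennreal (U \<mu> x powr (- (\<delta> * \<sigma>)) * e x) \<partial>L)"
        unfolding X_def by (intro nn_integral_cong) (simp add: space_L e_\<Phi>)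
      then have "ennreal k * X = (\<integral>\<^sup>+x. ennreal k * ennreal (U \<mu> x powr (- (\<delta> * \<sigma>)) * e x) \<partial>L)"
        by (simp add: nn_integral_cmult)
      also have "\<dots> = (\<integral>\<^sup>+x. ennreal (k * U \<mu> x powr (- (\<delta> * \<sigma>))) * ennreal (e x) \<partial>L)"
        using k_pos e_nonneg by (intro nn_integral_cong) (simp add: space_L mult.assoc flip: ennreal_mult)
      finally show ?thesis .
    qed
    have le: "(\<Sum>n. ennreal (K n x * N n)) * ennreal (e x) \<le> ennreal (k * U \<mu> x powr (- (\<delta> * \<sigma>))) * ennreal (e x)" if "0 < x" for x
      using seq_weight_sum_less[OF that] by (intro mult_right_mono) auto
    show "R < ennreal k * X"
      unfolding R_def kX
    proof (rule nn_integral_less)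
      show "AE x in L. (\<Sum>n. ennreal (K n x * N n)) * ennreal (e x) \<le> ennreal (k * U \<mu> x powr (- (\<delta> * \<sigma>))) * ennreal (e x)"
        using le by (intro AE_I2) (simp add: space_L)
      have "R \<le> ennreal k * X"
        unfolding R_def kX using le by (intro nn_integral_mono) (simp add: space_L)
      moreover have "ennreal k * X \<noteq> top" using X by (simp add: ennreal_mult_eq_top_iff)
      ultimately show "(\<integral>\<^sup>+x. (\<Sum>n. ennreal (K n x * N n)) * ennreal (e x) \<partial>L) \<noteq> \<infinity>"
        unfolding R_def by (auto simp: top_unique)
      \<comment> \<open>Where \<open>e\<close> is positive the weight bound is strict, so the
        reverse inequality almost everywhere would give \<open>f\<close> norm 0.\<close>
      show "\<not> (AE x in L. ennreal (k * U \<mu> x powr (- (\<delta> * \<sigma>))) * ennreal (e x) \<le> (\<Sum>n. ennreal (K n x * N n)) * ennreal (e x))"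
      proof
        assume "AE x in L. ennreal (k * U \<mu> x powr (- (\<delta> * \<sigma>))) * ennreal (e x) \<le> (\<Sum>n. ennreal (K n x * N n)) * ennreal (e x)"
        moreover have "AE x in L. x \<in> space L" by (rule AE_space)
        ultimately have "AE x in L. ennreal (\<Phi> p \<sigma> \<delta> \<mu> x * f x powr p) = 0"
        proof eventually_elim
          case (elim x)
          then have x: "0 < x" by (simp add: space_L)
          have "e x = 0"
          proof (rule ccontr)
            assume "e x \<noteq> 0"
            then have "0 < ennreal (e x)" using e_nonneg[OF x] by simp
            then have "ennreal (e x) * (\<Sum>n. ennreal (K n x * N n)) < ennreal (e x) * ennreal (k * U \<mu> x powr (- (\<delta> * \<sigma>)))"
              by (intro ennreal_mult_strict_left_mono seq_weight_sum_less x) auto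
            then show False using elim by (simp add: mult.commute)
          qed
          then show ?case unfolding e_\<Phi>[OF x, symmetric] by simp
        qed
        then have "X = 0"
          unfolding X_def using nn_integral_cong_AE by force
        then show False using X by simp
      qed
    qed measurable
  qed (use k_pos in auto)
  also have "\<dots> = epowr (ennreal k * fnorm f) p"
    using k_pos pq by (simp add: fnorm epowr_mult epowr_epowr powr_diff flip: ennreal_mult mult.assoc)
  finally show ?thesis
    unfolding seq_transform_def using pq by (intro epowr_root_less) auto
qed

text \<open>Here the discrete weight comes first, through Hoelder for the sum at each
  \<open>x\<close>, and the exact integral weight evaluates what is left. Strictness at
  \<open>x\<close> requires \<open>Z x\<close> to be positive and finite.\<close>

lemma fun_transform_less:
  assumes adm: "adm_seq a"
  shows "fun_transform a < ennreal k * snorm a"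
proof -
  have a: "\<And>n. 0 \<le> a (Suc n)"
    using adm by (auto simp: admissible_seq_def)
  define Y where "Y = (\<Sum>n. ennreal (\<Psi> q \<sigma> \<beta> \<nu> (Suc n) * a (Suc n) powr q))"
  have snorm: "snorm a = epowr Y (1 / q)" by (simp add: seq_norm_def Y_def)
  have Y: "Y \<noteq> 0" "Y \<noteq> top"
    using adm unfolding admissible_seq_def snorm by auto
  define e where "e n = N n * (a (Suc n) / N n) powr q" for n
  have e_nonneg: "0 \<le> e n" for n using N_pos[of n] by (simp add: e_def)
  have e_\<Psi>: "W n powr (- \<sigma>) * e n = \<Psi> q \<sigma> \<beta> \<nu> (Suc n) * a (Suc n) powr q" for n
  proof -
    have "e n = N n powr (1 - q) * a (Suc n) powr q"
      using N_pos[of n] a[of n] by (simp add: e_def powr_divide powr_diff)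
    then show ?thesis by (simp add: \<Psi>_eq)
  qed
  define Z where "Z x = (\<Sum>n. ennreal (K n x * e n))" for x
  have [measurable]: "Z \<in> borel_measurable L" unfolding Z_def[abs_def] by measurable
  have Z_int: "(\<integral>\<^sup>+x. ennreal (m x) * Z x \<partial>L) = ennreal k * Y"
  proof -
    have "(\<integral>\<^sup>+x. ennreal (m x) * Z x \<partial>L) = (\<integral>\<^sup>+x. (\<Sum>n. ennreal (e n) * ennreal (K n x * m x)) \<partial>L)"
    proof (rule nn_integral_cong)
      fix x assume "x \<in> space L"
      then have x: "0 < x" by (simp add: space_L)
      have "ennreal (e n) * ennreal (K n x * m x) = ennreal (m x) * ennreal (K n x * e n)" for n
        using e_nonneg[of n] K_pos[OF x, of n] m_pos[OF x] by (simp add: mult_ac flip: ennreal_mult)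
      then show "ennreal (m x) * Z x = (\<Sum>n. ennreal (e n) * ennreal (K n x * m x))"
        by (simp add: Z_def ennreal_suminf_cmult)
    qed
    also have "\<dots> = (\<Sum>n. ennreal (e n) * (\<integral>\<^sup>+x. ennreal (K n x * m x) \<partial>L))"
      by (simp add: nn_integral_suminf nn_integral_cmult)
    also have "\<dots> = (\<Sum>n. ennreal k * ennreal (\<Psi> q \<sigma> \<beta> \<nu> (Suc n) * a (Suc n) powr q))"
    proof (rule suminf_cong)
      fix n
      show "ennreal (e n) * (\<integral>\<^sup>+x. ennreal (K n x * m x) \<partial>L) = ennreal k * ennreal (\<Psi> q \<sigma> \<beta> \<nu> (Suc n) * a (Suc n) powr q)"
        unfolding fun_weight_integral e_\<Psi>[symmetric]
        using k_pos e_nonneg[of n] by (simp add: mult_ac flip: ennreal_mult)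
    qed
    also have "\<dots> = ennreal k * Y" by (simp add: Y_def ennreal_suminf_cmult)
    finally show ?thesis .
  qed
  have kY: "ennreal k * Y \<noteq> top" using Y by (simp add: ennreal_mult_eq_top_iff)
  \<comment> \<open>The nonzero norm provides one positive term, which makes \<open>Z\<close>
    positive everywhere.\<close>
  obtain i where i: "0 < a (Suc i)"
  proof (rule ccontr)
    assume "\<not> thesis"
    then have "a (Suc n) = 0" for n using that a[of n] by (metis less_le)
    then have "Y = 0" by (simp add: Y_def)
    then show False using Y by simp
  qed
  have Z_pos: "0 < Z x" if x: "0 < x" for x
  proof -
    have "0 < K i x * e i"
      using K_pos[OF x, of i] N_pos[of i] i by (simp add: e_def)
    then have "0 < ennreal (K i x * e i)" by simp
    also have "\<dots> \<le> Z x"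
      unfolding Z_def using sum_le_suminf[of "\<lambda>n. ennreal (K n x * e n)" "{i}"] by simp
    finally show ?thesis .
  qed
  let ?u = "\<lambda>x. U \<mu> x powr ((q - 1) * (\<delta> * \<sigma>))"
  let ?S = "\<lambda>x. \<Sum>n. ennreal (K n x * N n)"
  have jensen: "epowr (\<Sum>n. ennreal (K n x * a (Suc n))) q \<le> epowr (?S x) (q - 1) * Z x" if x: "0 < x" for x
  proof -
    have "ennreal (K n x * a (Suc n)) = ennreal (K n x * N n) * ennreal (a (Suc n) / N n)" for n
      using K_pos[OF x, of n] N_pos[of n] a[of n] by (simp flip: ennreal_mult)
    moreover have "ennreal (K n x * N n) * epowr (ennreal (a (Suc n) / N n)) q = ennreal (K n x * e n)" for n
      using K_pos[OF x, of n] N_pos[of n] a[of n] by (simp add: e_def mult_ac flip: ennreal_mult)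
    ultimately show ?thesis
      using epowr_nn_integral_weighted_le[of "\<lambda>n. ennreal (K n x * N n)" "count_space UNIV"
        "\<lambda>n. ennreal (a (Suc n) / N n)" q] pq
      by (simp add: nn_integral_count_space_nat Z_def)
  qed
  have bound: "ennreal (m x * ?u x) * epowr (ennreal (k * U \<mu> x powr (- (\<delta> * \<sigma>)))) (q - 1)
      = ennreal (k powr (q - 1)) * ennreal (m x)" if x: "0 < x" for x
  proof -
    have "?u x * (U \<mu> x powr (- (\<delta> * \<sigma>))) powr (q - 1) = 1"
      using U_pos[OF x] by (simp add: powr_powr algebra_simps flip: powr_add)
    moreover have "(k * U \<mu> x powr (- (\<delta> * \<sigma>))) powr (q - 1) = k powr (q - 1) * (U \<mu> x powr (- (\<delta> * \<sigma>))) powr (q - 1)"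
      using k_pos by (simp add: powr_mult)
    moreover have "m x * ?u x * (k powr (q - 1) * (U \<mu> x powr (- (\<delta> * \<sigma>))) powr (q - 1))
        = k powr (q - 1) * m x * (?u x * (U \<mu> x powr (- (\<delta> * \<sigma>))) powr (q - 1))"
      by (simp only: mult_ac)
    ultimately have "m x * ?u x * (k * U \<mu> x powr (- (\<delta> * \<sigma>))) powr (q - 1) = k powr (q - 1) * m x"
      by (simp only: mult_1_right)
    then show ?thesis
      using k_pos m_pos[OF x] by (simp flip: ennreal_mult)
  qed
  let ?lhs = "\<lambda>x. ennreal (m x * ?u x) * epowr (\<Sum>n. ennreal (K n x * a (Suc n))) q"
  let ?rhs = "\<lambda>x. ennreal (k powr (q - 1)) * (ennreal (m x) * Z x)"
  have rhs: "?rhs x = ennreal (m x * ?u x) * (epowr (ennreal (k * U \<mu> x powr (- (\<delta> * \<sigma>)))) (q - 1) * Z x)" if "0 < x" for x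
    using bound[OF that] by (metis mult.assoc)
  have le: "?lhs x \<le> ?rhs x" if x: "0 < x" for x
  proof -
    have "epowr (?S x) (q - 1) * Z x \<le> epowr (ennreal (k * U \<mu> x powr (- (\<delta> * \<sigma>)))) (q - 1) * Z x"
      using seq_weight_sum_less[OF x] pq by (intro mult_right_mono epowr_mono) auto
    then show ?thesis
      unfolding rhs[OF x] using jensen[OF x] by (intro mult_left_mono) auto
  qed
  have less: "?lhs x < ?rhs x" if x: "0 < x" and Z: "Z x \<noteq> top" for x
  proof -
    have "Z x * epowr (?S x) (q - 1) < Z x * epowr (ennreal (k * U \<mu> x powr (- (\<delta> * \<sigma>)))) (q - 1)"
      using seq_weight_sum_less[OF x] pq Z_pos[OF x] Z
      by (intro ennreal_mult_strict_left_mono epowr_strict_mono) (auto simp: less_top)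
    then have "epowr (\<Sum>n. ennreal (K n x * a (Suc n))) q < epowr (ennreal (k * U \<mu> x powr (- (\<delta> * \<sigma>)))) (q - 1) * Z x"
      using jensen[OF x] by (simp add: mult.commute)
    then show ?thesis
      unfolding rhs[OF x] using m_pos[OF x] U_pos[OF x]
      by (intro ennreal_mult_strict_left_mono) auto
  qed
  have rhs_int: "(\<integral>\<^sup>+x. ?rhs x \<partial>L) = ennreal (k powr (q - 1)) * (ennreal k * Y)"
    by (simp add: nn_integral_cmult Z_int)
  have "(\<integral>\<^sup>+x. ?lhs x \<partial>L) < (\<integral>\<^sup>+x. ?rhs x \<partial>L)"
  proof (rule nn_integral_less)
    show "AE x in L. ?lhs x \<le> ?rhs x"
      using le by (intro AE_I2) (simp add: space_L)
    have "(\<integral>\<^sup>+x. ?lhs x \<partial>L) \<le> (\<integral>\<^sup>+x. ?rhs x \<partial>L)"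
      using le by (intro nn_integral_mono) (simp add: space_L)
    moreover have "(\<integral>\<^sup>+x. ?rhs x \<partial>L) \<noteq> top"
      unfolding rhs_int using kY by (simp add: ennreal_mult_eq_top_iff)
    ultimately show "(\<integral>\<^sup>+x. ?lhs x \<partial>L) \<noteq> \<infinity>" by (auto simp: top_unique)
    show "\<not> (AE x in L. ?rhs x \<le> ?lhs x)"
    proof
      assume "AE x in L. ?rhs x \<le> ?lhs x"
      \<comment> \<open>Strictness may fail where \<open>Z\<close> is infinite, but finiteness of
        the integral of \<open>m * Z\<close> confines this to a null set.\<close>
      moreover have "AE x in L. ennreal (m x) * Z x \<noteq> \<infinity>"
        using kY by (intro nn_integral_PInf_AE) (auto simp: Z_int)
      moreover have "AE x in L. x \<in> space L" by (rule AE_space)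
      ultimately have "AE x in L. False"
      proof eventually_elim
        case (elim x)
        then have x: "0 < x" by (simp add: space_L)
        then have "Z x \<noteq> top" using elim m_pos[OF x] by (auto simp: ennreal_mult_eq_top_iff)
        then show ?case using less[OF x] elim by simp
      qed
      \<comment> \<open>Falsity almost everywhere would mean a null measure; the positive integral
        of \<open>K 0 x * m x\<close> refutes it.\<close>
      then have "AE x in L. ennreal (K 0 x * m x) = 0" by eventually_elim simp
      then have "ennreal (k * W 0 powr (- \<sigma>)) = 0"
        unfolding fun_weight_integral[symmetric] by (subst nn_integral_0_iff_AE) auto
      then show False using k_pos W_pos[of 0] by simp
    qed
  qed measurable
  also have "\<dots> = epowr (ennreal k * snorm a) q"
    unfolding rhs_int
    using k_pos pq by (simp add: snorm epowr_mult epowr_epowr powr_diff flip: ennreal_mult mult.assoc)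
  finally show ?thesis
    unfolding fun_transform_def using pq by (intro epowr_root_less) auto
qed

end

section \<open>Optimality of the constant\<close>

context hardy_setting begin

text \<open>Monotone convergence over intervals exhausting the half-line. They are symmetric under
  inversion, so one parameter controls both ends, and \<open>i + 2\<close> makes it exceed 1 already
  for i = 0.\<close>

lemma truncated_kernel_integral:
  assumes "c < k"
  shows "\<exists>B>1. ennreal c < (\<integral>\<^sup>+t. ennreal (Kfun \<alpha> \<rho> \<gamma> t * indicator {1 / B..B} t * t powr (\<sigma> - 1)) \<partial>L)"
proof -
  let ?g = "\<lambda>i t. ennreal (Kfun \<alpha> \<rho> \<gamma> t * indicator {1 / (real i + 2)..real i + 2} t * t powr (\<sigma> - 1))"
  have sup: "(SUP i. ?g i t) = ennreal (Kfun \<alpha> \<rho> \<gamma> t * t powr (\<sigma> - 1))" if t: "0 < t" for t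
  proof (rule antisym)
    show "(SUP i. ?g i t) \<le> ennreal (Kfun \<alpha> \<rho> \<gamma> t * t powr (\<sigma> - 1))"
      using Kfun_pos[OF \<rho>(1) t] by (intro SUP_least ennreal_leI) (auto split: split_indicator simp: less_imp_le)
    obtain i :: nat where i: "max t (1 / t) < real i" using reals_Archimedean2 by blast
    then have "1 / (real i + 2) \<le> t" "t \<le> real i + 2"
      using t by (auto simp: field_simps)
    then have "ennreal (Kfun \<alpha> \<rho> \<gamma> t * t powr (\<sigma> - 1)) = ?g i t" by simp
    also have "\<dots> \<le> (SUP i. ?g i t)" by (rule SUP_upper) simp
    finally show "ennreal (Kfun \<alpha> \<rho> \<gamma> t * t powr (\<sigma> - 1)) \<le> (SUP i. ?g i t)" .
  qed
  have "(SUP i. \<integral>\<^sup>+t. ?g i t \<partial>L) = (\<integral>\<^sup>+t. (SUP i. ?g i t) \<partial>L)"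
  proof (rule nn_integral_monotone_convergence_SUP_AE[symmetric])
    fix i
    have "1 / (real (Suc i) + 2) \<le> 1 / (real i + 2)" by (intro divide_left_mono) auto
    then have "indicator {1 / (real i + 2)..real i + 2} t
        \<le> (indicator {1 / (real (Suc i) + 2)..real (Suc i) + 2} t :: real)" for t
      by (auto split: split_indicator)
    then have "?g i t \<le> ?g (Suc i) t" if "0 < t" for t
      using Kfun_pos[OF \<rho>(1) that, of \<alpha> \<gamma>]
      by (intro ennreal_leI mult_right_mono mult_left_mono) (auto simp: less_imp_le)
    then show "AE t in L. ?g i t \<le> ?g (Suc i) t"
      by (intro AE_I2) (simp only: space_L)
    show "?g i \<in> borel_measurable L"
      by (intro borel_measurable_lebesgue_on) measurable
  qed
  also have "\<dots> = (\<integral>\<^sup>+t. ennreal (Kfun \<alpha> \<rho> \<gamma> t * t powr (\<sigma> - 1)) \<partial>L)"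
    by (intro nn_integral_cong sup) (simp only: space_L)
  also have "\<dots> = ennreal k"
    using \<rho> \<gamma>\<sigma> by (simp add: nn_integral_Kfun_powr)
  finally have "ennreal c < (SUP i. \<integral>\<^sup>+t. ?g i t \<partial>L)"
    using assms k_pos by (simp add: ennreal_lessI)
  then obtain i where "ennreal c < (\<integral>\<^sup>+t. ?g i t \<partial>L)"
    by (auto simp: less_SUP_iff)
  then show ?thesis by (intro exI[of _ "real i + 2"]) auto
qed

text \<open>The right side is the relative increment \<open>\<nu> (n + 2) / W n\<close>, and
  \<open>ln (1 + x) \<le> x\<close>.\<close>

lemma N_W_ge: "ln (W (Suc n)) - ln (W n) \<le> N n * W n powr (- \<sigma>)"
proof -
  have "ln (W (Suc n)) - ln (W n) = ln (1 + \<nu> (Suc (Suc n)) / W n)"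
  proof -
    have "1 + \<nu> (Suc (Suc n)) / W n = W (Suc n) / W n"
      using W_pos[of n] by (simp add: W_Suc add_divide_distrib)
    then show ?thesis
      using W_pos[of n] W_pos[of "Suc n"] by (simp add: ln_div)
  qed
  also have "\<dots> \<le> \<nu> (Suc (Suc n)) / W n"
    using W_pos[of n] \<nu>_pos[of "Suc (Suc n)"] by (intro ln_add_one_self_le_self) simp
  also have "\<dots> = N n * W n powr (- \<sigma>)"
    using W_pos[of n] by (simp add: N_def powr_diff powr_minus field_simps)
  finally show ?thesis .
qed

lemma sum_N_W_ge: "ln (W M) - ln (W 0) \<le> (\<Sum>n\<le>M. N n * W n powr (- \<sigma>))"
proof -
  have "ln (W M) - ln (W 0) = (\<Sum>n<M. ln (W (Suc n)) - ln (W n))"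
    by (rule sum_lessThan_telescope[of "\<lambda>n. ln (W n)", symmetric])
  also have "\<dots> \<le> (\<Sum>n<M. N n * W n powr (- \<sigma>))"
    by (intro sum_mono N_W_ge)
  \<comment> \<open>Telescoping up to \<open>W M\<close> uses only indices below \<open>M\<close>;
    the last term is positive and can be added.\<close>
  also have "\<dots> \<le> (\<Sum>n\<le>M. N n * W n powr (- \<sigma>))"
    using seq_weight_pos by (intro sum_mono2) (auto intro: less_imp_le)
  finally show ?thesis .
qed

text \<open>In the normalised variables the extremal functions are constant; they are cut off to a range
  on which both norms are of logarithmic size. The cut-off of the function exceeds the one matching
  the sequence by the fixed factor \<open>B\<close> at both ends, so every inner integral is close to \<open>k\<close>.\<close>

definition test_seq :: "nat \<Rightarrow> nat \<Rightarrow> real" where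
  "test_seq M j = (if 1 \<le> j \<and> j \<le> Suc M then N (j - 1) else 0)"

definition test_fun :: "real \<Rightarrow> real \<Rightarrow> real \<Rightarrow> real" where
  "test_fun a b x = m x * indicator {a..b} (U \<mu> x powr \<delta>)"

lemma snorm_test_seq: "snorm (test_seq M) = ennreal ((\<Sum>n\<le>M. N n * W n powr (- \<sigma>)) powr (1 / q))"
proof -
  have "(\<Sum>n. ennreal (\<Psi> q \<sigma> \<beta> \<nu> (Suc n) * test_seq M (Suc n) powr q))
      = (\<Sum>n\<le>M. ennreal (N n * W n powr (- \<sigma>)))"
  proof (subst suminf_finite[of "{..M}"])
    show "(\<Sum>n\<le>M. ennreal (\<Psi> q \<sigma> \<beta> \<nu> (Suc n) * test_seq M (Suc n) powr q)) = (\<Sum>n\<le>M. ennreal (N n * W n powr (- \<sigma>)))"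
    proof (rule sum.cong[OF refl])
      fix n assume "n \<in> {..M}"
      then show "ennreal (\<Psi> q \<sigma> \<beta> \<nu> (Suc n) * test_seq M (Suc n) powr q) = ennreal (N n * W n powr (- \<sigma>))"
        using N_pos[of n] by (simp add: test_seq_def \<Psi>_eq powr_diff)
    qed
  qed (auto simp: test_seq_def)
  also have "\<dots> = ennreal (\<Sum>n\<le>M. N n * W n powr (- \<sigma>))"
    using N_pos by (intro sum_ennreal) (simp add: less_imp_le)
  finally show ?thesis
    using N_pos by (simp add: seq_norm_def sum_nonneg less_imp_le)
qed

lemma borel_measurable_test_fun [measurable]: "test_fun a b \<in> borel_measurable L"
  unfolding test_fun_def[abs_def] by measurable

text \<open>In the variable \<open>s = U powr \<delta>\<close> the integrand of the norm is
  \<open>ds / s\<close> on the window from \<open>a\<close> to \<open>b\<close>, whence the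
  logarithms.\<close>

lemma fnorm_test_fun:
  assumes ab: "0 < a" "a \<le> b"
  shows "fnorm (test_fun a b) = ennreal ((ln b - ln a) powr (1 / p))"
proof -
  define g where "g t = t powr (- \<sigma>) * indicator {a..b} t" for t
  have [measurable]: "g \<in> borel_measurable borel" unfolding g_def[abs_def] by measurable
  have I: "(\<integral>\<^sup>+t. ennreal (g t * t powr (\<sigma> - 1)) \<partial>L) = ennreal (ln b - ln a)"
  proof -
    have "(\<integral>\<^sup>+t. ennreal (g t * t powr (\<sigma> - 1)) \<partial>L) = (\<integral>\<^sup>+t. ennreal (inverse t) * indicator {a..b} t \<partial>lborel)"
      unfolding nn_integral_lebesgue_on
    proof (rule nn_integral_cong)
      fix t
      have "t powr (- \<sigma>) * t powr (\<sigma> - 1) = inverse t" if "0 < t"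
        using that by (simp add: powr_diff powr_minus field_simps)
      then show "ennreal (g t * t powr (\<sigma> - 1)) * indicator {0<..} t = ennreal (inverse t) * indicator {a..b} t"
        using ab by (auto simp: g_def split: split_indicator)
    qed
    also have "\<dots> = ennreal (ln b - ln a)"
      using ab by (intro nn_integral_FTC_Icc) (auto intro!: derivative_eq_intros simp: divide_inverse)
    finally show ?thesis .
  qed
  have g: "0 \<le> g t" for t by (simp add: g_def)
  have "integrable L (\<lambda>t. g t * t powr (\<sigma> - 1))"
    using I g by (intro integrableI_nonneg borel_measurable_lebesgue_on) auto
  then have *: "(\<integral>\<^sup>+x. ennreal (g (1 * U \<mu> x powr \<delta>) * m x) \<partial>L) = ennreal (ln b - ln a)"
    using g by (subst nn_integral_m) (auto simp: I)
  have "(\<integral>\<^sup>+x. ennreal (\<Phi> p \<sigma> \<delta> \<mu> x * test_fun a b x powr p) \<partial>L) = ennreal (ln b - ln a)"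
    unfolding *[symmetric]
  proof (rule nn_integral_cong)
    fix x assume "x \<in> space L"
    then have x: "0 < x" by (simp add: space_L)
    have "m x powr (1 - p) * U \<mu> x powr (- (\<delta> * \<sigma>)) * m x powr p = U \<mu> x powr (- (\<delta> * \<sigma>)) * m x"
      using m_pos[OF x] by (simp add: powr_diff)
    then have "\<Phi> p \<sigma> \<delta> \<mu> x * m x powr p = U \<mu> x powr (- (\<delta> * \<sigma>)) * m x"
      by (simp add: \<Phi>_eq[OF x])
    then show "ennreal (\<Phi> p \<sigma> \<delta> \<mu> x * test_fun a b x powr p) = ennreal (g (1 * U \<mu> x powr \<delta>) * m x)"
      using pq by (auto simp: test_fun_def g_def powr_powr split: split_indicator)
  qed
  moreover have "ln a \<le> ln b" using ab by simp
  ultimately show ?thesis by (simp add: fun_norm_def)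
qed

text \<open>If \<open>W n * u\<close> lies between \<open>1 / B\<close> and \<open>B\<close> for
  some n \<le> M, monotonicity of \<open>W\<close> puts \<open>u\<close> into the window of the test
  function. Hence no inner integral loses any of the truncated kernel.\<close>

lemma bilinear_test_ge:
  assumes B: "1 < B" and c: "0 < c" and int: "ennreal c < (\<integral>\<^sup>+t. ennreal (Kfun \<alpha> \<rho> \<gamma> t * indicator {1 / B..B} t * t powr (\<sigma> - 1)) \<partial>L)"
  shows "ennreal (c * (\<Sum>n\<le>M. N n * W n powr (- \<sigma>))) \<le> bilinear (test_fun (1 / (B * W M)) (B / W 0)) (test_seq M)"
proof -
  let ?f = "test_fun (1 / (B * W M)) (B / W 0)"
  define g where "g t = Kfun \<alpha> \<rho> \<gamma> t * indicator {1 / B..B} t" for t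
  have [measurable]: "g \<in> borel_measurable borel" unfolding g_def[abs_def] by measurable
  have g: "0 \<le> g t" if "0 < t" for t
    using Kfun_pos[OF \<rho>(1) that] by (simp add: g_def less_imp_le)
  have g_int: "integrable L (\<lambda>t. g t * t powr (\<sigma> - 1))"
  proof (rule Bochner_Integration.integrable_bound)
    show "integrable L (\<lambda>t. Kfun \<alpha> \<rho> \<gamma> t * t powr (\<sigma> - 1))"
      by (intro integrable_Kfun_powr \<rho> \<gamma>\<sigma>)
    show "AE t in L. norm (g t * t powr (\<sigma> - 1)) \<le> norm (Kfun \<alpha> \<rho> \<gamma> t * t powr (\<sigma> - 1))"
      by (intro AE_I2) (simp add: g_def split: split_indicator)
  qed (intro borel_measurable_lebesgue_on, measurable)
  have summand: "ennreal (N n * W n powr (- \<sigma>)) * ennreal c \<le> (\<integral>\<^sup>+x. ennreal (K n x * test_seq M (Suc n) * ?f x) \<partial>L)" if n: "n \<le> M" for n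
  proof -
    have "ennreal (W n powr (- \<sigma>)) * ennreal c \<le> (\<integral>\<^sup>+x. ennreal (g (W n * U \<mu> x powr \<delta>) * m x) \<partial>L)"
      using int by (subst nn_integral_m[OF _ W_pos g g_int]) (auto simp: g_def intro: mult_left_mono less_imp_le)
    then have "ennreal (N n) * (ennreal (W n powr (- \<sigma>)) * ennreal c) \<le> ennreal (N n) * (\<integral>\<^sup>+x. ennreal (g (W n * U \<mu> x powr \<delta>) * m x) \<partial>L)"
      by (rule mult_left_mono) simp
    also have "\<dots> = (\<integral>\<^sup>+x. ennreal (N n) * ennreal (g (W n * U \<mu> x powr \<delta>) * m x) \<partial>L)"
      by (rule nn_integral_cmult[symmetric]) measurable
    also have "\<dots> \<le> (\<integral>\<^sup>+x. ennreal (K n x * test_seq M (Suc n) * ?f x) \<partial>L)"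
    proof (rule nn_integral_mono)
      fix x assume "x \<in> space L"
      then have x: "0 < x" by (simp add: space_L)
      define u where "u = U \<mu> x powr \<delta>"
      have u: "0 < u" using U_pos[OF x] by (simp add: u_def)
      have "indicator {1 / B..B} (W n * u) \<le> (indicator {1 / (B * W M)..B / W 0} u :: real)"
      proof -
        have "1 / (B * W M) \<le> u" if "1 / B \<le> W n * u"
        proof -
          have "W n * u \<le> W M * u" using u n by (intro mult_right_mono W_mono) auto
          then have "1 / B \<le> W M * u" using that by simp
          then show ?thesis using B W_pos[of M] by (simp add: field_simps)
        qed
        moreover have "u \<le> B / W 0" if "W n * u \<le> B"
        proof -
          have "W 0 * u \<le> W n * u" using u by (intro mult_right_mono W_mono) auto
          then have "W 0 * u \<le> B" using that by simp
          then show ?thesis using W_pos[of 0] by (simp add: field_simps)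
        qed
        ultimately show ?thesis by (auto split: split_indicator)
      qed
      then have "g (W n * u) * m x \<le> K n x * indicator {1 / (B * W M)..B / W 0} u * m x"
        unfolding g_def K_def u_def[symmetric]
        using Kfun_pos[OF \<rho>(1), of "W n * u" \<alpha> \<gamma>] W_pos[of n] u m_pos[OF x]
        by (intro mult_right_mono mult_left_mono) (auto simp: less_imp_le)
      then have "N n * (g (W n * u) * m x) \<le> N n * (K n x * indicator {1 / (B * W M)..B / W 0} u * m x)"
        using N_pos[of n] by (intro mult_left_mono) auto
      also have "N n * (K n x * indicator {1 / (B * W M)..B / W 0} u * m x) = K n x * test_seq M (Suc n) * ?f x"
        using n by (simp add: test_fun_def test_seq_def u_def)
      finally show "ennreal (N n) * ennreal (g (W n * U \<mu> x powr \<delta>) * m x) \<le> ennreal (K n x * test_seq M (Suc n) * ?f x)"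
        unfolding u_def[symmetric] using N_pos[of n] by (subst ennreal_mult'[symmetric]) (auto intro: ennreal_leI less_imp_le)
    qed
    finally show ?thesis
      using N_pos[of n] by (simp add: ennreal_mult mult.assoc less_imp_le)
  qed
  have "ennreal (c * (\<Sum>n\<le>M. N n * W n powr (- \<sigma>))) = (\<Sum>n\<le>M. ennreal (N n * W n powr (- \<sigma>)) * ennreal c)"
  proof -
    have "ennreal (N n * W n powr (- \<sigma>)) * ennreal c = ennreal (c * (N n * W n powr (- \<sigma>)))" for n
      using c seq_weight_pos[of n "- \<sigma>"] by (simp add: mult.commute flip: ennreal_mult)
    moreover have "0 \<le> c * (N n * W n powr (- \<sigma>))" for n
      using c seq_weight_pos[of n "- \<sigma>"] by simp
    ultimately show ?thesis by (simp add: sum_distrib_left sum_ennreal)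
  qed
  also have "\<dots> \<le> (\<Sum>n\<le>M. \<integral>\<^sup>+x. ennreal (K n x * test_seq M (Suc n) * ?f x) \<partial>L)"
    by (intro sum_mono summand) simp
  also have "\<dots> \<le> bilinear ?f (test_seq M)"
    unfolding bilinear_def by (rule sum_le_suminf) auto
  finally show ?thesis .
qed

lemma constant_optimal:
  assumes V_lim: "filterlim (V \<nu>) at_top sequentially" and c: "0 < c" "c < k"
  shows "\<exists>f a. adm_fun f \<and> adm_seq a \<and> ennreal c * fnorm f * snorm a < bilinear f a"
proof -
  obtain d where d: "c < d" "d < k" using c dense by blast
  obtain B where B: "1 < B" "ennreal d < (\<integral>\<^sup>+t. ennreal (Kfun \<alpha> \<rho> \<gamma> t * indicator {1 / B..B} t * t powr (\<sigma> - 1)) \<partial>L)"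
    using truncated_kernel_integral[OF d(2)] by blast
  \<comment> \<open>The goal reduces to \<open>c * D powr (1 / p) < d * S powr (1 / p)\<close>;
    taking p-th powers and dividing turns this into \<open>D < r * S\<close>.\<close>
  define r where "r = (d / c) powr p"
  have r: "1 < r" using c d pq by (simp add: r_def gr_one_powr)
  \<comment> \<open>The part of \<open>D\<close> that does not depend on \<open>M\<close>:
    \<open>D = C + ln (W M)\<close>.\<close>
  define C where "C = 2 * ln B - ln (W 0)"
  have "filterlim (\<lambda>n. V \<nu> (Suc n)) at_top sequentially"
    using V_lim by (simp add: filterlim_sequentially_Suc)
  \<comment> \<open>This is \<open>C + ln (W M) < r * (ln (W M) - ln (W 0))\<close> solved for
    \<open>W M\<close>; adding 1 makes the bound strict, and \<beta> passes from \<open>V\<close> to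
    \<open>W\<close>.\<close>
  then have "\<forall>\<^sub>F n in sequentially. exp ((C + r * ln (W 0)) / (r - 1)) + 1 + \<beta> \<le> V \<nu> (Suc n)"
    by (simp add: filterlim_at_top)
  then obtain M where "exp ((C + r * ln (W 0)) / (r - 1)) + 1 + \<beta> \<le> V \<nu> (Suc M)"
    by (auto simp: eventually_sequentially)
  then have "exp ((C + r * ln (W 0)) / (r - 1)) < W M" by (simp add: W_def)
  then have "(C + r * ln (W 0)) / (r - 1) < ln (W M)"
    using W_pos[of M] by (metis exp_less_cancel_iff exp_ln)
  then have M: "C + r * ln (W 0) < (r - 1) * ln (W M)"
    using r by (simp add: divide_less_eq mult.commute)
  define S where "S = (\<Sum>n\<le>M. N n * W n powr (- \<sigma>))"
  define D where "D = ln (B / W 0) - ln (1 / (B * W M))"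
  let ?f = "test_fun (1 / (B * W M)) (B / W 0)"
  have S: "0 < S" unfolding S_def using N_pos W_pos by (intro sum_pos) (auto simp: less_imp_neq[symmetric])
  have D_eq: "D = C + ln (W M)"
    using B W_pos[of 0] W_pos[of M] by (simp add: D_def C_def ln_div ln_mult)
  have ab: "0 < 1 / (B * W M)" "1 / (B * W M) < B / W 0"
  proof -
    have "W 0 * 1 < W M * (B * B)"
      using B W_mono[of 0 M] W_pos[of 0] less_1_mult[of B B] by (intro mult_le_less_imp_less) auto
    then show "1 / (B * W M) < B / W 0"
      using B W_pos[of 0] W_pos[of M] by (simp add: field_simps)
  qed (use B W_pos[of M] in simp)
  have D: "0 < D" unfolding D_def using ab ln_less_cancel_iff[of "1 / (B * W M)" "B / W 0"] by linarith
  have "D < r * S"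
  proof -
    have "D < r * (ln (W M) - ln (W 0))" using M by (simp add: D_eq algebra_simps)
    also have "\<dots> \<le> r * S" unfolding S_def using r by (intro mult_left_mono sum_N_W_ge) auto
    finally show ?thesis .
  qed
  then have "D powr (1 / p) < (r * S) powr (1 / p)"
    using D pq by (intro powr_less_mono2) auto
  also have "\<dots> = d / c * S powr (1 / p)"
    using S r c d pq by (simp add: powr_mult r_def powr_powr)
  finally have "c * D powr (1 / p) < d * S powr (1 / p)"
    using c by (simp add: field_simps)
  then have "c * D powr (1 / p) * S powr (1 / q) < d * S powr (1 / p) * S powr (1 / q)"
    using S by (intro mult_strict_right_mono) auto
  also have "\<dots> = d * S"
    using S pq by (simp add: mult.assoc flip: powr_add)
  finally have less: "c * D powr (1 / p) * S powr (1 / q) < d * S" .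
  have fn: "fnorm ?f = ennreal (D powr (1 / p))"
    unfolding D_def using ab by (intro fnorm_test_fun) auto
  have sn: "snorm (test_seq M) = ennreal (S powr (1 / q))"
    unfolding S_def by (rule snorm_test_seq)
  have "ennreal c * fnorm ?f * snorm (test_seq M) = ennreal (c * D powr (1 / p) * S powr (1 / q))"
    using c by (simp add: fn sn ennreal_mult)
  also have "\<dots> < ennreal (d * S)"
    using less c d S by (intro ennreal_lessI) auto
  also have "\<dots> \<le> bilinear ?f (test_seq M)"
    unfolding S_def using c d by (intro bilinear_test_ge B) auto
  finally have "ennreal c * fnorm ?f * snorm (test_seq M) < bilinear ?f (test_seq M)" .
  moreover have "adm_fun ?f"
  proof -
    have "0 \<le> ?f x" if "0 < x" for x using m_pos[OF that] by (simp add: test_fun_def)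
    then show ?thesis
      unfolding admissible_fun_def fn using D by (simp add: less_top[symmetric])
  qed
  moreover have "adm_seq (test_seq M)"
  proof -
    have "0 \<le> test_seq M n" for n using N_pos[of "n - 1"] by (simp add: test_seq_def)
    then show ?thesis
      unfolding admissible_seq_def sn using S by (simp add: less_top[symmetric])
  qed
  ultimately show ?thesis by blast
qed

end

theorem theorem3p2:
  fixes \<alpha> \<rho> \<gamma> \<sigma> \<beta> \<delta> p q :: real
    and \<nu> :: "nat \<Rightarrow> real" and \<mu> :: "real \<Rightarrow> real"
  assumes "\<forall>n\<ge>1. 0 < \<nu> n"
    and "\<forall>n\<ge>1. \<nu> (Suc n) \<le> \<nu> n"
    and "\<beta> \<le> \<nu> 1 / 2"
    and "continuous_on {0<..} \<mu>"
    and "\<forall>x>0. 0 < \<mu> x"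
    and "\<forall>x>0. integrable (lebesgue_on {0<..x}) \<mu>"
    and "\<delta> \<in> {-1, 1}"
    and "\<rho> > max 0 (- \<alpha>)"
    and "0 < \<gamma>" and "\<gamma> < \<sigma>" and "\<sigma> \<le> 1"
    and "p > 1" and "1 / p + 1 / q = 1"
    and "filterlim (U \<mu>) at_top at_top"
    and "filterlim (V \<nu>) at_top sequentially"
  shows
    "best_constant
       (\<lambda>c. \<forall>f a. admissible_fun p (\<Phi> p \<sigma> \<delta> \<mu>) f \<and> admissible_seq q (\<Psi> q \<sigma> \<beta> \<nu>) a \<longrightarrow>
          (\<Sum>n. \<integral>\<^sup>+x. ennreal (hardy_kernel \<alpha> \<rho> \<gamma> \<beta> \<delta> \<mu> \<nu> x (Suc n) * a (Suc n) * f x) \<partial>lebesgue_on {0<..})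
            < ennreal c * fun_norm p (\<Phi> p \<sigma> \<delta> \<mu>) f * seq_norm q (\<Psi> q \<sigma> \<beta> \<nu>) a)
       (kconst \<alpha> \<rho> \<gamma> \<sigma>) \<and>
     best_constant
       (\<lambda>c. \<forall>f. admissible_fun p (\<Phi> p \<sigma> \<delta> \<mu>) f \<longrightarrow>
          epowr (\<Sum>n. ennreal (\<nu> (Suc (Suc n)) / (V \<nu> (Suc n) - \<beta>) powr (1 - p * \<sigma>)) *
                   epowr (\<integral>\<^sup>+x. ennreal (hardy_kernel \<alpha> \<rho> \<gamma> \<beta> \<delta> \<mu> \<nu> x (Suc n) * f x) \<partial>lebesgue_on {0<..}) p)
            (1 / p)
            < ennreal c * fun_norm p (\<Phi> p \<sigma> \<delta> \<mu>) f)
       (kconst \<alpha> \<rho> \<gamma> \<sigma>) \<and>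
     best_constant
       (\<lambda>c. \<forall>a. admissible_seq q (\<Psi> q \<sigma> \<beta> \<nu>) a \<longrightarrow>
          epowr (\<integral>\<^sup>+x. ennreal (\<mu> x / U \<mu> x powr (1 - q * \<delta> * \<sigma>)) *
                   epowr (\<Sum>n. ennreal (hardy_kernel \<alpha> \<rho> \<gamma> \<beta> \<delta> \<mu> \<nu> x (Suc n) * a (Suc n))) q \<partial>lebesgue_on {0<..})
            (1 / q)
            < ennreal c * seq_norm q (\<Psi> q \<sigma> \<beta> \<nu>) a)
       (kconst \<alpha> \<rho> \<gamma> \<sigma>)"
proof -
  have "1 / p < 1" using assms(12) by simp
  then have "0 < 1 / q" using assms(13) by linarith
  moreover have "1 / q < 1"
  proof -
    have "0 < 1 / p" using assms(12) by simp
    then show ?thesis using assms(13) by linarith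
  qed
  ultimately have q: "1 < q" by (simp add: divide_less_eq)
  interpret hardy_setting \<nu> \<beta> \<mu> \<alpha> \<rho> \<gamma> \<sigma> \<delta> p q
    using assms q by unfold_locales auto
  have fun_finite: "0 < fnorm f \<and> fnorm f < top" if "adm_fun f" for f
    using that by (simp add: admissible_fun_def)
  have seq_finite: "0 < snorm a \<and> snorm a < top" if "adm_seq a" for a
    using that by (simp add: admissible_seq_def)
  have le_seq: "bilinear f a \<le> seq_transform f * snorm a" if "adm_fun f" "adm_seq a" for f a
    using that by (intro bilinear_le_seq_transform) (auto simp: admissible_fun_def admissible_seq_def)
  have le_fun: "bilinear f a \<le> fun_transform a * fnorm f" if "adm_fun f" "adm_seq a" for f a
    using that by (intro bilinear_le_fun_transform) (auto simp: admissible_fun_def admissible_seq_def)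
  have "bilinear f a < ennreal k * fnorm f * snorm a" if "adm_fun f" "adm_seq a" for f a
  proof -
    \<comment> \<open>Multiplication stays strict because the norm of \<open>a\<close> is positive
      and finite.\<close>
    have "snorm a * seq_transform f < snorm a * (ennreal k * fnorm f)"
      using seq_transform_less[OF that(1)] seq_finite[OF that(2)] by (intro ennreal_mult_strict_left_mono) auto
    then show ?thesis using le_seq[OF that] by (simp add: mult.commute)
  qed
  moreover have "\<exists>f a. adm_fun f \<and> adm_seq a \<and> \<not> bilinear f a < ennreal c * fnorm f * snorm a"
    if c: "0 < c" "c < k" for c
    using constant_optimal[OF assms(15) c] by (meson order_less_asym)
  moreover have "\<exists>f. adm_fun f \<and> \<not> seq_transform f < ennreal c * fnorm f" if c: "0 < c" "c < k" for c
  proof -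
    obtain f a where fa: "adm_fun f" "adm_seq a" "ennreal c * fnorm f * snorm a < bilinear f a"
      using constant_optimal[OF assms(15) c] by blast
    have "ennreal c * fnorm f * snorm a < seq_transform f * snorm a"
      using fa(3) le_seq[OF fa(1,2)] by (rule less_le_trans)
    \<comment> \<open>Otherwise multiplying by \<open>snorm a\<close> would contradict the
      inequality for the extremal pair.\<close>
    then have "\<not> seq_transform f < ennreal c * fnorm f"
      by (meson leD less_imp_le mult_right_mono zero_le)
    then show ?thesis using fa by blast
  qed
  moreover have "\<exists>a. adm_seq a \<and> \<not> fun_transform a < ennreal c * snorm a" if c: "0 < c" "c < k" for c
  proof -
    obtain f a where fa: "adm_fun f" "adm_seq a" "ennreal c * fnorm f * snorm a < bilinear f a"
      using constant_optimal[OF assms(15) c] by blast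
    have "ennreal c * snorm a * fnorm f < fun_transform a * fnorm f"
      using fa(3) le_fun[OF fa(1,2)] by (simp add: mult_ac)
    then have "\<not> fun_transform a < ennreal c * snorm a"
      by (meson leD less_imp_le mult_right_mono zero_le)
    then show ?thesis using fa by blast
  qed
  ultimately show ?thesis
    unfolding best_constant_def hardy_kernel_eq seq_weight_eq fun_weight_eq
      bilinear_def[symmetric] seq_transform_def[symmetric] fun_transform_def[symmetric]
    using seq_transform_less fun_transform_less by blast
qed

end
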